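(* Let $M_1,\dots,M_k$ be matroids on a common ground set $U$ with $|U|=n$ and let $\mathbf{x}\in\bigcap_{j=1}^kP(M_j)$. The $k$-matroid AW scheme on $M_1,\dots,M_k$ and $\mathbf{x}$ yields a strongly $k$-bounded sequential selection process: with ground set $U$, input vector $\mathbf{x}$, the scheme's random order $\sigma$ and random set $R$, and output $X_e=\mathbf 1[e\in S]$ where $S$ is the final output of the scheme, there is a choice of vectors $\mathbf{p}(t)$ making this a sequential selection process that is strongly $k$-bounded.
   Context: $P(M)\subseteq[0,1]^U$ is the convex hull of the indicator vectors of independent sets of $M$. Exchange mapping: for independent sets $I,J$ of a matroid $(U,\mathcal I)$, an exchange mapping is a function $\phi:I\to J\cup\{\perp\}$ such that (1) $\phi(e)=e$ if $e\in I\cap J$; (2) if $\phi(e)=\perp$ then $J+e\in\mathcal I$; (3) if $\phi(e)=f\ne\perp$ then $J+e-f\in\mathcal I$; (4) for every $f\in J$ there is at most one $e\in I$ with $\phi(e)=f$. Such mappings always exist. Single-matroid AW scheme. Input: a matroid $M=(U,\mathcal I)$, a point $\mathbf{x}\in P(M)$, and a random set $R\subseteq U$ containing each $e$ independently with probability $x_e$. Initialization: $S=\emptyset$; write $\mathbf{x}=\sum_{i=1}^{m}\beta_i\mathbf 1_{I_i}$ as a convex combination ($\beta_i\ge0$, $\sum_i\beta_i=1$, $m\le n+1$) of indicator vectors of independent sets $I_1,\dots,I_m$; the sets $I_i$ will be updated over time, the weights $\beta_i$ never change. Each element $e$ with $x_e>0$ independently selects a controller index $i$ among those with $e\in I_i$,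 $\beta_i\neq 0$ (for the initial sets), index $i$ being selected with probability $\beta_i/x_e$. For each ordered pair $(i,j)$ the scheme maintains an exchange mapping $\phi_{ij}$ from the current $I_i$ to the current $I_j$. Iteration: choose a uniformly random ordering $\sigma:[n]\to U$ and process elements in this order. When $e=\sigma(t)$ is processed, $e$ is added to $S$ if and only if $e\in R$ and $e$ still belongs to the current set $I_i$, where $i$ is the controller of $e$. If $e$ is added to $S$, every $I_j$ with $\beta_j\ne0$ is updated by deleting $\phi_{ij}(e)$ (if $\phi_{ij}(e)\ne\perp$) and adding $e$. The output is the final $S$. $k$-matroid AW scheme: run the single-matroid AW scheme for each $M_j$ (with its own decomposition, controllers and exchange mappings) using the same random order $\sigma$ and the same random set $R$, obtaining $S_1,\dots,S_k$; output $S=\bigcap_{j=1}^k S_j$. A sequential selection process is a random process of the following form. Input: a ground set $U$ of $n$ elements and a vector $\mathbf{x}\in[0,1]^n$ indexed by $U$. The process maintains a vector $\mathbf{p}$, with initial value $\mathbf{p}(1)=\mathbf{x}$, and a vector $\mathbf{X}\in\{0,1\}^n$, initially zero. It generates a uniformly random ordering $\sigma$ of $U$ and a random set $R\subseteq U$ containing each $e$ independently with probability $x_e$, revealed step by step: at time step $t=1,\dots,n$ it chooses a uniformly random element $e\notin\{\sigma(1),\dots,\sigma(t-1)\}$, sets $\sigma(t)=e$, and includes $e$ in $R$ independently with probability $x_e$. Then: (i) if $e\notin R$, $X_e=0$; if $e\in R$, $X_e$ is set to $1$ with some arbitrary probability (possibly depending on past events) that is at least $p_e(t)/x_e$, and to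 $0$ otherwise; (ii) a vector $\mathbf{\Delta}(t)\in[0,1]^n$ with $0\le\Delta_{e'}(t)\le p_{e'}(t)$ for all $e'\in U$ is generated arbitrarily, and $\mathbf{p}(t+1)=\mathbf{p}(t)-\mathbf{\Delta}(t)$. The output is the final $\mathbf{X}$. Let $\mathcal F_{t-1}$ denote the state (history) of the process after completion of time step $t-1$ (for the AW scheme, controllers of not yet processed elements are regarded as not yet revealed). The process is $\lambda$-bounded if $\mathbb{E}[\Delta_e(t)\mid\mathcal F_{t-1}]\le\frac{\lambda x_e}{n-t+1}$ for all $e\in U$ and $t\in[n]$; it is $\lambda$-limited if always $\|\mathbf{\Delta}(t)\|_1\le\lambda$ for all $t$; it is strongly $\lambda$-bounded if it is both $\lambda$-bounded and $\lambda$-limited. *)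

theory Defs
  imports "HOL-Probability.Probability"
begin

definition matroid :: "'u set \<Rightarrow> 'u set set \<Rightarrow> bool" where
  "matroid U \<I> \<longleftrightarrow>
     finite U \<and> \<I> \<subseteq> Pow U \<and> {} \<in> \<I> \<and>
     (\<forall>J\<in>\<I>. \<forall>I. I \<subseteq> J \<longrightarrow> I \<in> \<I>) \<and>
     (\<forall>I\<in>\<I>. \<forall>J\<in>\<I>. card I < card J \<longrightarrow> (\<exists>e\<in>J - I. insert e I \<in> \<I>))"

text \<open>
  The ground set is a subset \<open>U\<close> of a finite type, so that the library notion of convex hull
  applies. Vectors indexed by \<open>U\<close> are vectors over the whole type, of which only the components
  in \<open>U\<close> matter.
\<close>

definition indicator_vec :: "'u set \<Rightarrow> real ^ 'u::finite" where
  "indicator_vec A = (\<chi> e. indicator A e)"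

definition matroid_polytope :: "'u::finite set set \<Rightarrow> (real ^ 'u) set" where
  "matroid_polytope \<I> = convex hull (indicator_vec ` \<I>)"

text \<open>The value \<open>None\<close> plays the role of \<open>\<bottom>\<close>.\<close>

definition exchange_mapping ::
    "'u set set \<Rightarrow> 'u set \<Rightarrow> 'u set \<Rightarrow> ('u \<Rightarrow> 'u option) \<Rightarrow> bool" where
  "exchange_mapping \<I> I J \<phi> \<longleftrightarrow>
     (\<forall>e\<in>I. \<forall>f. \<phi> e = Some f \<longrightarrow> f \<in> J) \<and>
     (\<forall>e\<in>I \<inter> J. \<phi> e = Some e) \<and>
     (\<forall>e\<in>I. \<phi> e = None \<longrightarrow> insert e J \<in> \<I>) \<and>
     (\<forall>e\<in>I. \<forall>f. \<phi> e = Some f \<longrightarrow> insert e J - {f} \<in> \<I>) \<and>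
     (\<forall>f\<in>J. \<forall>e\<in>I. \<forall>e'\<in>I. \<phi> e = Some f \<longrightarrow> \<phi> e' = Some f \<longrightarrow> e = e')"

definition convex_decomposition ::
    "'u::finite set \<Rightarrow> 'u set set \<Rightarrow> real ^ 'u \<Rightarrow> nat \<Rightarrow> (nat \<Rightarrow> real) \<Rightarrow> (nat \<Rightarrow> 'u set) \<Rightarrow> bool" where
  "convex_decomposition U \<I> x m \<beta> I \<longleftrightarrow>
     m \<le> card U + 1 \<and>
     (\<forall>i\<in>{1..m}. I i \<in> \<I> \<and> 0 \<le> \<beta> i) \<and>
     (\<Sum>i=1..m. \<beta> i) = 1 \<and>
     x = (\<Sum>i=1..m. \<beta> i *\<^sub>R indicator_vec (I i))"

definition random_set_pmf :: "'u::finite set \<Rightarrow> real ^ 'u \<Rightarrow> 'u set pmf" where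
  "random_set_pmf U x =
     map_pmf (\<lambda>b. {e\<in>U. b e}) (Pi_pmf U False (\<lambda>e. bernoulli_pmf (x $ e)))"

text \<open>
  For a convex decomposition of \<open>x\<close> and an element \<open>e\<close> with \<open>x $ e > 0\<close>, the weights below sum
  to 1, so \<^const>\<open>embed_pmf\<close> yields a distribution with exactly these probabilities.
\<close>

definition controller_pmf ::
    "real ^ 'u::finite \<Rightarrow> nat \<Rightarrow> (nat \<Rightarrow> real) \<Rightarrow> (nat \<Rightarrow> 'u set) \<Rightarrow> 'u \<Rightarrow> nat pmf" where
  "controller_pmf x m \<beta> I e =
     embed_pmf (\<lambda>i. if i \<in> {1..m} \<and> e \<in> I i \<and> \<beta> i \<noteq> 0 then \<beta> i / x $ e else 0)"

text \<open>
  Elements with \<open>x $ e = 0\<close> have no controller. They get the dummy index 0, which is never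
  consulted, as such elements almost surely do not belong to the random set.
\<close>

definition controllers_pmf ::
    "'u::finite set \<Rightarrow> real ^ 'u \<Rightarrow> nat \<Rightarrow> (nat \<Rightarrow> real) \<Rightarrow> (nat \<Rightarrow> 'u set) \<Rightarrow> ('u \<Rightarrow> nat) pmf" where
  "controllers_pmf U x m \<beta> I = Pi_pmf {e\<in>U. x $ e > 0} 0 (controller_pmf x m \<beta> I)"

text \<open>
  What a single-matroid run with controllers \<open>c\<close>, order \<open>\<sigma>\<close> and random set \<open>R\<close> has revealed
  after \<open>t\<close> steps: the processed elements in order, each with its membership in \<open>R\<close> and its
  controller. Orders are lists, so \<open>\<sigma> ! t\<close> is the element processed in step number \<open>t + 1\<close>.
\<close>

type_synonym 'u aw_hist = "('u \<times> bool \<times> nat) list"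

definition aw_history :: "('u \<Rightarrow> nat) \<Rightarrow> 'u list \<Rightarrow> 'u set \<Rightarrow> nat \<Rightarrow> 'u aw_hist" where
  "aw_history c \<sigma> R t = map (\<lambda>e. (e, e \<in> R, c e)) (take t \<sigma>)"

text \<open>
  An exchange rule \<open>\<phi>\<close> chooses the exchange mappings in dependence on what has been revealed:
  \<open>\<phi> h i j\<close> is the mapping used, after history \<open>h\<close>, from the current \<open>I\<^sub>i\<close> to the current \<open>I\<^sub>j\<close>.
  The state of a run consists of the current sets \<open>I\<^sub>j\<close> and the current selection.
\<close>

type_synonym 'u exchange_rule = "'u aw_hist \<Rightarrow> nat \<Rightarrow> nat \<Rightarrow> 'u \<Rightarrow> 'u option"

primrec aw_state ::
    "(nat \<Rightarrow> real) \<Rightarrow> (nat \<Rightarrow> 'u set) \<Rightarrow> 'u exchange_rule \<Rightarrow>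
     ('u \<Rightarrow> nat) \<Rightarrow> 'u list \<Rightarrow> 'u set \<Rightarrow> nat \<Rightarrow> (nat \<Rightarrow> 'u set) \<times> 'u set" where
  "aw_state \<beta> I \<phi> c \<sigma> R 0 = (I, {})"
| "aw_state \<beta> I \<phi> c \<sigma> R (Suc t) =
     (let (J, S) = aw_state \<beta> I \<phi> c \<sigma> R t;
          e = \<sigma> ! t;
          i = c e;
          \<psi> = \<phi> (aw_history c \<sigma> R t)
      in if e \<in> R \<and> e \<in> J i
         then (\<lambda>j. if \<beta> j \<noteq> 0 then insert e (J j - set_option (\<psi> i j e)) else J j, insert e S)
         else (J, S))"

definition maintains_exchange_mappings ::
    "'u::finite set \<Rightarrow> 'u set set \<Rightarrow> real ^ 'u \<Rightarrow> nat \<Rightarrow> (nat \<Rightarrow> real) \<Rightarrow> (nat \<Rightarrow> 'u set) \<Rightarrow>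
     'u exchange_rule \<Rightarrow> bool" where
  "maintains_exchange_mappings U \<I> x m \<beta> I \<phi> \<longleftrightarrow>
     (\<forall>c\<in>set_pmf (controllers_pmf U x m \<beta> I). \<forall>\<sigma>\<in>permutations_of_set U.
      \<forall>R\<in>set_pmf (random_set_pmf U x). \<forall>t<card U. \<forall>i\<in>{1..m}. \<forall>j\<in>{1..m}.
        (let J = fst (aw_state \<beta> I \<phi> c \<sigma> R t)
         in exchange_mapping \<I> (J i) (J j) (\<phi> (aw_history c \<sigma> R t) i j)))"

text \<open>
  The sample space of the scheme for \<open>k\<close> matroids: the controllers \<open>c j e\<close> for each matroid \<open>j\<close>,
  the order, and the random set, all independent.
\<close>

type_synonym 'u aw_outcome = "(nat \<Rightarrow> 'u \<Rightarrow> nat) \<times> 'u list \<times> 'u set"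

definition aw_pmf ::
    "nat \<Rightarrow> 'u::finite set \<Rightarrow> real ^ 'u \<Rightarrow> (nat \<Rightarrow> nat) \<Rightarrow> (nat \<Rightarrow> nat \<Rightarrow> real) \<Rightarrow>
     (nat \<Rightarrow> nat \<Rightarrow> 'u set) \<Rightarrow> 'u aw_outcome pmf" where
  "aw_pmf k U x m \<beta> I =
     pair_pmf (Pi_pmf {1..k} (\<lambda>_. 0) (\<lambda>j. controllers_pmf U x (m j) (\<beta> j) (I j)))
       (pair_pmf (pmf_of_set (permutations_of_set U)) (random_set_pmf U x))"

definition aw_order :: "'u aw_outcome \<Rightarrow> nat \<Rightarrow> 'u" where
  "aw_order = (\<lambda>(c, \<sigma>, R) t. \<sigma> ! (t - 1))"

definition aw_random_set :: "'u aw_outcome \<Rightarrow> 'u set" where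
  "aw_random_set = (\<lambda>(c, \<sigma>, R). R)"

definition aw_output ::
    "nat \<Rightarrow> 'u set \<Rightarrow> (nat \<Rightarrow> nat \<Rightarrow> real) \<Rightarrow> (nat \<Rightarrow> nat \<Rightarrow> 'u set) \<Rightarrow> (nat \<Rightarrow> 'u exchange_rule) \<Rightarrow>
     'u aw_outcome \<Rightarrow> 'u set" where
  "aw_output k U \<beta> I \<phi> =
     (\<lambda>(c, \<sigma>, R). \<Inter>j\<in>{1..k}. snd (aw_state (\<beta> j) (I j) (\<phi> j) (c j) \<sigma> R (card U)))"

definition aw_joint_history ::
    "nat \<Rightarrow> 'u aw_outcome \<Rightarrow> ('u \<times> bool \<times> (nat \<Rightarrow> nat)) list" where
  "aw_joint_history t = (\<lambda>(c, \<sigma>, R). map (\<lambda>e. (e, e \<in> R, \<lambda>j. c j e)) (take t \<sigma>))"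

text \<open>
  Conditioning on a discrete random variable \<open>Z\<close>, evaluated at the outcome \<open>\<omega>\<close>, and
  measurability with respect to \<open>Z\<close>.
\<close>

definition given :: "'w pmf \<Rightarrow> ('w \<Rightarrow> 'z) \<Rightarrow> 'w \<Rightarrow> 'w pmf" where
  "given P Z \<omega> = cond_pmf P {\<omega>'. Z \<omega>' = Z \<omega>}"

definition determined_by :: "'w pmf \<Rightarrow> ('w \<Rightarrow> 'z) \<Rightarrow> ('w \<Rightarrow> 'y) \<Rightarrow> bool" where
  "determined_by P Z Y \<longleftrightarrow> (\<forall>\<omega>\<in>set_pmf P. \<forall>\<omega>'\<in>set_pmf P. Z \<omega> = Z \<omega>' \<longrightarrow> Y \<omega> = Y \<omega>')"

text \<open>
  A sequential selection process on a discrete probability space. Time steps are numbered from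
  1, and \<open>H t\<close> is the history after step \<open>t\<close>, so conditioning on \<open>H (t - 1)\<close> is conditioning on
  the past of step \<open>t\<close>. That the randomness of step \<open>t\<close> is drawn in the order: element,
  membership in \<open>R\<close>, value of \<open>X\<close>, shows in the three successive conditionings.
\<close>

locale sequential_selection_process =
  fixes P :: "'w pmf"
    and U :: "'u::finite set"
    and x :: "real ^ 'u"
    and H :: "nat \<Rightarrow> 'w \<Rightarrow> 'h"
    and \<sigma> :: "'w \<Rightarrow> nat \<Rightarrow> 'u"
    and R :: "'w \<Rightarrow> 'u set"
    and X :: "'w \<Rightarrow> real ^ 'u"
    and p :: "nat \<Rightarrow> 'w \<Rightarrow> real ^ 'u"
    and \<Delta> :: "nat \<Rightarrow> 'w \<Rightarrow> real ^ 'u"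
  assumes input: "\<And>e. e \<in> U \<Longrightarrow> 0 \<le> x $ e \<and> x $ e \<le> 1"
    and order: "\<And>\<omega>. \<omega> \<in> set_pmf P \<Longrightarrow> bij_betw (\<sigma> \<omega>) {1..card U} U"
    and random_set: "\<And>\<omega>. \<omega> \<in> set_pmf P \<Longrightarrow> R \<omega> \<subseteq> U"
    and output_01: "\<And>\<omega> e. \<omega> \<in> set_pmf P \<Longrightarrow> e \<in> U \<Longrightarrow> X \<omega> $ e \<in> {0, 1}"
    and history_mono: "\<And>t. t \<in> {1..card U} \<Longrightarrow> determined_by P (H t) (H (t - 1))"
    and history_adapted: "\<And>t. t \<in> {1..card U} \<Longrightarrow> determined_by P (H t)
          (\<lambda>\<omega>. (\<sigma> \<omega> t, \<sigma> \<omega> t \<in> R \<omega>, X \<omega> $ \<sigma> \<omega> t, \<Delta> t \<omega>))"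
    and order_uniform: "\<And>t \<omega> e. t \<in> {1..card U} \<Longrightarrow> \<omega> \<in> set_pmf P \<Longrightarrow> e \<in> U - \<sigma> \<omega> ` {1..<t} \<Longrightarrow>
          measure_pmf.prob (given P (H (t - 1)) \<omega>) {\<omega>'. \<sigma> \<omega>' t = e}
            = 1 / (real (card U) - real t + 1)"
    and random_set_prob: "\<And>t \<omega>. t \<in> {1..card U} \<Longrightarrow> \<omega> \<in> set_pmf P \<Longrightarrow>
          measure_pmf.prob (given P (\<lambda>\<omega>'. (H (t - 1) \<omega>', \<sigma> \<omega>' t)) \<omega>) {\<omega>'. \<sigma> \<omega>' t \<in> R \<omega>'}
            = x $ \<sigma> \<omega> t"
    and unselected: "\<And>t \<omega>. t \<in> {1..card U} \<Longrightarrow> \<omega> \<in> set_pmf P \<Longrightarrow> \<sigma> \<omega> t \<notin> R \<omega> \<Longrightarrow> X \<omega> $ \<sigma> \<omega> t = 0"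
    and selected_prob: "\<And>t \<omega>. t \<in> {1..card U} \<Longrightarrow> \<omega> \<in> set_pmf P \<Longrightarrow> \<sigma> \<omega> t \<in> R \<omega> \<Longrightarrow>
          measure_pmf.prob (given P (\<lambda>\<omega>'. (H (t - 1) \<omega>', \<sigma> \<omega>' t, \<sigma> \<omega>' t \<in> R \<omega>')) \<omega>)
            {\<omega>'. X \<omega>' $ \<sigma> \<omega>' t = 1} \<ge> p t \<omega> $ \<sigma> \<omega> t / x $ \<sigma> \<omega> t"
    and p_initial: "\<And>\<omega>. \<omega> \<in> set_pmf P \<Longrightarrow> p 1 \<omega> = x"
    and p_step: "\<And>t \<omega>. t \<in> {1..card U} \<Longrightarrow> \<omega> \<in> set_pmf P \<Longrightarrow> p (t + 1) \<omega> = p t \<omega> - \<Delta> t \<omega>"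
    and \<Delta>_range: "\<And>t \<omega> e. t \<in> {1..card U} \<Longrightarrow> \<omega> \<in> set_pmf P \<Longrightarrow> e \<in> U \<Longrightarrow>
          0 \<le> \<Delta> t \<omega> $ e \<and> \<Delta> t \<omega> $ e \<le> p t \<omega> $ e \<and> \<Delta> t \<omega> $ e \<le> 1"

definition bounded_process ::
    "real \<Rightarrow> 'w pmf \<Rightarrow> 'u::finite set \<Rightarrow> real ^ 'u \<Rightarrow> (nat \<Rightarrow> 'w \<Rightarrow> 'h) \<Rightarrow>
     (nat \<Rightarrow> 'w \<Rightarrow> real ^ 'u) \<Rightarrow> bool" where
  "bounded_process b P U x H \<Delta> \<longleftrightarrow>
     (\<forall>t\<in>{1..card U}. \<forall>e\<in>U. \<forall>\<omega>\<in>set_pmf P.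
        measure_pmf.expectation (given P (H (t - 1)) \<omega>) (\<lambda>\<omega>'. \<Delta> t \<omega>' $ e)
          \<le> b * x $ e / (real (card U) - real t + 1))"

definition limited_process ::
    "real \<Rightarrow> 'w pmf \<Rightarrow> 'u::finite set \<Rightarrow> (nat \<Rightarrow> 'w \<Rightarrow> real ^ 'u) \<Rightarrow> bool" where
  "limited_process b P U \<Delta> \<longleftrightarrow>
     (\<forall>t\<in>{1..card U}. \<forall>\<omega>\<in>set_pmf P. (\<Sum>e\<in>U. \<bar>\<Delta> t \<omega> $ e\<bar>) \<le> b)"

definition strongly_bounded_process ::
    "real \<Rightarrow> 'w pmf \<Rightarrow> 'u::finite set \<Rightarrow> real ^ 'u \<Rightarrow> (nat \<Rightarrow> 'w \<Rightarrow> 'h) \<Rightarrow>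
     (nat \<Rightarrow> 'w \<Rightarrow> real ^ 'u) \<Rightarrow> bool" where
  "strongly_bounded_process b P U x H \<Delta> \<longleftrightarrow>
     bounded_process b P U x H \<Delta> \<and> limited_process b P U \<Delta>"

end

theory Submission
  imports Defs
begin

text \<open>
  For one matroid let \<open>y\<^sub>e\<close> be the total weight of the current sets that contain \<open>e\<close>. Given the
  past, an unprocessed \<open>e\<close> still belongs to the set of its controller with probability \<open>y\<^sub>e / x\<^sub>e\<close>.
  For several matroids these events are independent, and by Weierstrass' product inequality
  the product of these probabilities is at least \<open>1 - \<Sum>\<^sub>j (1 - y\<^sup>j\<^sub>e / x\<^sub>e)\<close>. So one takes for \<open>p\<^sub>e\<close>
  the positive part of \<open>x\<^sub>e - \<Sum>\<^sub>j (x\<^sub>e - y\<^sup>j\<^sub>e)\<close> until \<open>e\<close> is processed, and freezes it from then on.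

  In one step and for one matroid every current set loses at most one element, so the total loss
  is at most \<open>\<Sum> \<beta>\<^sub>i = 1\<close>. The new element is \<open>f\<close>, lies in \<open>R\<close> and has controller \<open>i\<close> with probability
  at most \<open>\<beta>\<^sub>i / (n - t + 1)\<close>. As \<open>\<phi>\<^sub>i\<^sub>j\<close> maps at most one \<open>f\<close> to \<open>e\<close>, the set with index \<open>j\<close> loses \<open>e\<close>
  with probability at most \<open>\<Sum> \<beta>\<^sub>i / (n - t + 1)\<close>, and \<open>y\<^sub>e\<close> drops by at most \<open>y\<^sub>e / (n - t + 1)\<close> in expectation.
\<close>

subsection \<open>Conditional distributions and product distributions\<close>

lemma set_pmf_given [simp]:
  assumes "\<omega> \<in> set_pmf P"
  shows "set_pmf (given P Z \<omega>) = {\<omega>' \<in> set_pmf P. Z \<omega>' = Z \<omega>}"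
  unfolding given_def using assms by (subst set_cond_pmf) auto

lemma prob_given:
  assumes "\<omega> \<in> set_pmf P"
  shows "measure_pmf.prob (given P Z \<omega>) A =
           measure_pmf.prob P {\<omega>'\<in>A. Z \<omega>' = Z \<omega>} / measure_pmf.prob P {\<omega>'. Z \<omega>' = Z \<omega>}"
proof -
  let ?S = "{\<omega>'. Z \<omega>' = Z \<omega>}"
  have ne: "set_pmf P \<inter> ?S \<noteq> {}"
    using assms by auto
  have "emeasure (measure_pmf P) ?S \<noteq> 0"
    using ne by (simp add: emeasure_measure_pmf_not_zero)
  then have "measure_pmf.prob (given P Z \<omega>) A =
      measure_pmf.prob P (?S \<inter> A) / measure_pmf.prob P ?S"
    unfolding given_def cond_pmf.rep_eq[OF ne] by (subst measure_uniform_measure) auto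
  then show ?thesis
    by (simp add: Int_def conj_commute)
qed

text \<open>A distribution has mass 1 on its own support, so agreement there leaves \<open>q\<close>
  no mass elsewhere. Conditional laws thus need checking only at attained values.\<close>

lemma pmf_eqI_support:
  assumes "\<And>y. y \<in> set_pmf p \<Longrightarrow> pmf p y = pmf q y"
  shows "p = q"
proof -
  have "emeasure q (set_pmf p) = (\<integral>\<^sup>+y. pmf q y \<partial>count_space (set_pmf p))"
    by (simp add: nn_integral_pmf)
  also have "\<dots> = (\<integral>\<^sup>+y. pmf p y \<partial>count_space (set_pmf p))"
    by (intro nn_integral_cong) (simp add: assms)
  also have "\<dots> = 1"
    by (simp add: nn_integral_pmf measure_pmf.emeasure_eq_1_AE AE_measure_pmf)
  finally have "emeasure q (set_pmf p) = 1" .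
  then have "AE y in q. y \<in> set_pmf p"
    by (simp add: measure_pmf.AE_prob_1 measure_pmf.emeasure_eq_measure)
  then have "set_pmf q \<subseteq> set_pmf p"
    by (auto simp: AE_measure_pmf_iff)
  then show ?thesis
    using assms by (intro pmf_eqI) (metis in_mono set_pmf_iff)
qed

lemma map_pmf_given_eqI:
  assumes "\<omega> \<in> set_pmf P"
    and "\<And>\<omega>'. \<omega>' \<in> set_pmf P \<Longrightarrow> Z \<omega>' = Z \<omega> \<Longrightarrow>
           measure_pmf.prob P {\<omega>''. Y \<omega>'' = Y \<omega>' \<and> Z \<omega>'' = Z \<omega>}
             = measure_pmf.prob P {\<omega>''. Z \<omega>'' = Z \<omega>} * pmf q (Y \<omega>')"
  shows "map_pmf Y (given P Z \<omega>) = q"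
proof (rule pmf_eqI_support)
  fix y
  assume "y \<in> set_pmf (map_pmf Y (given P Z \<omega>))"
  then obtain \<omega>' where \<omega>': "\<omega>' \<in> set_pmf P" "Z \<omega>' = Z \<omega>" "y = Y \<omega>'"
    using assms(1) by auto
  have "measure_pmf.prob P {\<omega>''. Z \<omega>'' = Z \<omega>} \<noteq> 0"
    using measure_pmf_posI[OF assms(1), of "{\<omega>''. Z \<omega>'' = Z \<omega>}"] by simp
  then show "pmf (map_pmf Y (given P Z \<omega>)) y = pmf q y"
    using assms(2)[OF \<omega>'(1,2)] by (simp add: pmf_map prob_given[OF assms(1)] \<omega>'(3))
qed

lemma pmf_bind_Pair: "pmf (bind_pmf q (\<lambda>y. map_pmf (Pair y) (r y))) (a, b) = pmf q a * pmf (r a) b"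
proof -
  have "pmf (map_pmf (Pair y) (r y)) (a, b) = indicator {a} y * pmf (r a) b" for y
  proof (cases "y = a")
    case True
    moreover have "Pair a -` {(a, b)} = {b}" by auto
    ultimately show ?thesis
      by (simp add: pmf_map measure_pmf_single)
  next
    case False
    then have "Pair y -` {(a, b)} = {}" by auto
    then show ?thesis using False by (simp add: pmf_map)
  qed
  then show ?thesis
    by (simp add: pmf_bind measure_pmf_single)
qed

lemma map_fst_bind_Pair: "map_pmf fst (bind_pmf q (\<lambda>y. map_pmf (Pair y) (r y))) = q"
  by (simp add: map_bind_pmf pmf.map_comp o_def bind_return_pmf')

text \<open>Chain rule for a two-stage draw: the first stage is the marginal, and dividing the joint
  probability by the marginal one leaves the second stage. Applied repeatedly, it separates the
  successive draws of one step.\<close>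

lemma map_pmf_given_chain:
  assumes "\<omega> \<in> set_pmf P"
    and "map_pmf (\<lambda>\<omega>'. (Y \<omega>', Y' \<omega>')) (given P Z \<omega>) = bind_pmf q (\<lambda>y. map_pmf (Pair y) (r y))"
  shows "map_pmf Y (given P Z \<omega>) = q"
    and "map_pmf Y' (given P (\<lambda>\<omega>'. (Z \<omega>', Y \<omega>')) \<omega>) = r (Y \<omega>)"
proof -
  have *: "map_pmf fst (map_pmf (\<lambda>\<omega>'. (Y \<omega>', Y' \<omega>')) (given P Z \<omega>)) = q"
    unfolding assms(2) by (rule map_fst_bind_Pair)
  then show marginal: "map_pmf Y (given P Z \<omega>) = q"
    by (simp add: pmf.map_comp o_def)
  show "map_pmf Y' (given P (\<lambda>\<omega>'. (Z \<omega>', Y \<omega>')) \<omega>) = r (Y \<omega>)"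
  proof (rule map_pmf_given_eqI[OF assms(1)])
    fix \<omega>'
    let ?z = "measure_pmf.prob P {\<omega>''. Z \<omega>'' = Z \<omega>}"
    have "?z \<noteq> 0"
      using measure_pmf_posI[OF assms(1), of "{\<omega>''. Z \<omega>'' = Z \<omega>}"] by simp
    moreover have "measure_pmf.prob P {\<omega>''. Y \<omega>'' = Y \<omega> \<and> Z \<omega>'' = Z \<omega>} / ?z = pmf q (Y \<omega>)"
      using arg_cong[OF marginal, of "\<lambda>p. pmf p (Y \<omega>)"] by (simp add: pmf_map prob_given[OF assms(1)])
    moreover have "measure_pmf.prob P {\<omega>''. (Y \<omega>'' = Y \<omega> \<and> Y' \<omega>'' = Y' \<omega>') \<and> Z \<omega>'' = Z \<omega>} / ?z
        = pmf q (Y \<omega>) * pmf (r (Y \<omega>)) (Y' \<omega>')"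
      using arg_cong[OF assms(2), of "\<lambda>p. pmf p (Y \<omega>, Y' \<omega>')"] 
      unfolding pmf_bind_Pair
      by (simp add: pmf_map prob_given[OF assms(1)])
    ultimately show "measure_pmf.prob P {\<omega>''. Y' \<omega>'' = Y' \<omega>' \<and> (Z \<omega>'', Y \<omega>'') = (Z \<omega>, Y \<omega>)}
        = measure_pmf.prob P {\<omega>''. (Z \<omega>'', Y \<omega>'') = (Z \<omega>, Y \<omega>)} * pmf (r (Y \<omega>)) (Y' \<omega>')"
      by (simp add: field_simps conj_commute conj_left_commute)
  qed
qed

section \<open>Probabilities of cylinder events\<close>

lemma prob_Pi_pmf_cylinder:
  assumes "finite D" "finite A"
  shows "measure_pmf.prob (Pi_pmf D d p) {f. \<forall>e\<in>A. f e = g e}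
           = (\<Prod>e\<in>A. pmf (if e \<in> D then p e else return_pmf d) (g e))"
proof -
  let ?p = "\<lambda>e. if e \<in> D then p e else return_pmf d"
  \<comment> \<open>Coordinates outside \<open>D\<close> are constantly \<open>d\<close>, so the
    index set can grow to \<open>D \<union> A\<close> with point masses at the new places.\<close>
  have "Pi_pmf D d p = Pi_pmf (D \<union> A) d ?p"
    using Pi_pmf_subset'[of "D \<union> A" D ?p d] assms by (simp cong: Pi_pmf_cong)
  moreover have "{f. \<forall>e\<in>A. f e = g e} = Pi (D \<union> A) (\<lambda>e. if e \<in> A then {g e} else UNIV)"
    by (auto simp: Pi_def)
  moreover have "(\<Prod>e\<in>D \<union> A. measure_pmf.prob (?p e) (if e \<in> A then {g e} else UNIV))
      = (\<Prod>e\<in>A. measure_pmf.prob (?p e) {g e})"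
    using assms by (intro prod.mono_neutral_cong_right) auto
  ultimately show ?thesis
    using assms by (simp add: measure_Pi_pmf_Pi pmf.rep_eq)
qed

lemma card_permutations_of_set_prefix:
  assumes "finite U" "distinct as" "set as \<subseteq> U"
  shows "card {\<sigma>\<in>permutations_of_set U. take (length as) \<sigma> = as} = fact (card U - length as)"
proof -
  have "{\<sigma>\<in>permutations_of_set U. take (length as) \<sigma> = as} = (@) as ` permutations_of_set (U - set as)"
  proof (intro equalityI subsetI)
    fix \<sigma> assume \<sigma>: "\<sigma> \<in> {\<sigma>\<in>permutations_of_set U. take (length as) \<sigma> = as}"
    define ys where "ys = drop (length as) \<sigma>"
    have "\<sigma> = as @ ys" using \<sigma> append_take_drop_id[of "length as" \<sigma>] by (simp add: ys_def)
    then show "\<sigma> \<in> (@) as ` permutations_of_set (U - set as)"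
      using \<sigma> by (auto simp: permutations_of_set_def)
  next
    fix \<sigma> assume "\<sigma> \<in> (@) as ` permutations_of_set (U - set as)"
    then show "\<sigma> \<in> {\<sigma>\<in>permutations_of_set U. take (length as) \<sigma> = as}"
      using assms by (auto simp: permutations_of_set_def)
  qed
  moreover have "card ((@) as ` permutations_of_set (U - set as)) = card (permutations_of_set (U - set as))"
    by (intro card_image) (auto simp: inj_on_def)
  ultimately show ?thesis
    using assms by (simp add: card_Diff_subset distinct_card)
qed

lemma prob_cong_support:
  assumes "\<And>\<omega>. \<omega> \<in> set_pmf P \<Longrightarrow> \<omega> \<in> A \<longleftrightarrow> \<omega> \<in> B"
  shows "measure_pmf.prob P A = measure_pmf.prob P B"
  using assms by (intro measure_pmf.finite_measure_eq_AE) (auto simp: AE_measure_pmf_iff)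

lemma prob_pair_pmf_Times:
  "measure_pmf.prob (pair_pmf M N) (A \<times> B) = measure_pmf.prob M A * measure_pmf.prob N B"
proof -
  \<comment> \<open>Intersecting with the supports makes both factors countable.\<close>
  have "measure_pmf.prob (pair_pmf M N) (A \<times> B)
      = measure_pmf.prob (pair_pmf M N) ((A \<inter> set_pmf M) \<times> (B \<inter> set_pmf N))"
    by (intro prob_cong_support) auto
  also have "\<dots> = measure_pmf.prob M (A \<inter> set_pmf M) * measure_pmf.prob N (B \<inter> set_pmf N)"
    by (intro measure_pmf_prob_product) auto
  finally show ?thesis
    by (simp add: measure_Int_set_pmf)
qed

subsection \<open>Runs for a single matroid\<close>

text \<open>The exchange rule reads only the history, so by induction the run does too. This lets
  current sets be treated as constants when conditioning on the past.\<close>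

lemma aw_state_cong:
  assumes "aw_history c \<sigma> R t = aw_history c' \<sigma>' R' t" "t \<le> length \<sigma>" "t \<le> length \<sigma>'"
  shows "aw_state \<beta> I \<phi> c \<sigma> R t = aw_state \<beta> I \<phi> c' \<sigma>' R' t"
  using assms
proof (induction t)
  case 0
  then show ?case by simp
next
  case (Suc t)
  have *: "aw_history c \<sigma> R (Suc t) = aw_history c \<sigma> R t @ [(\<sigma> ! t, \<sigma> ! t \<in> R, c (\<sigma> ! t))]"
    "aw_history c' \<sigma>' R' (Suc t) = aw_history c' \<sigma>' R' t @ [(\<sigma>' ! t, \<sigma>' ! t \<in> R', c' (\<sigma>' ! t))]"
    using Suc.prems by (simp_all add: aw_history_def take_Suc_conv_app_nth)
  then have eqs: "aw_history c \<sigma> R t = aw_history c' \<sigma>' R' t" "\<sigma> ! t = \<sigma>' ! t"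
    "\<sigma>' ! t \<in> R \<longleftrightarrow> \<sigma>' ! t \<in> R'" "c (\<sigma>' ! t) = c' (\<sigma>' ! t)"
    using Suc.prems(1) by auto
  have "aw_state \<beta> I \<phi> c \<sigma> R t = aw_state \<beta> I \<phi> c' \<sigma>' R' t"
    using Suc eqs(1) by simp
  with eqs show ?case
    by (simp only: aw_state.simps Let_def case_prod_unfold)
qed

text \<open>The selection only grows, and each step decides about its own element alone. Questions
  on the output thus become questions on current sets.\<close>

lemma snd_aw_state:
  "snd (aw_state \<beta> I \<phi> c \<sigma> R T) =
     {\<sigma> ! s |s. s < T \<and> \<sigma> ! s \<in> R \<and> \<sigma> ! s \<in> fst (aw_state \<beta> I \<phi> c \<sigma> R s) (c (\<sigma> ! s))}"
  by (induction T) (auto simp: Let_def case_prod_unfold less_Suc_eq)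

text \<open>Only the element being processed is ever inserted, so any other element can change its
  membership only by being exchanged out.\<close>

lemma mem_aw_state_Suc:
  assumes "e \<noteq> \<sigma> ! t"
  shows "e \<in> fst (aw_state \<beta> I \<phi> c \<sigma> R (Suc t)) i \<longleftrightarrow>
           e \<in> fst (aw_state \<beta> I \<phi> c \<sigma> R t) i \<and>
           \<not> (\<sigma> ! t \<in> R \<and> \<sigma> ! t \<in> fst (aw_state \<beta> I \<phi> c \<sigma> R t) (c (\<sigma> ! t)) \<and> \<beta> i \<noteq> 0 \<and>
              \<phi> (aw_history c \<sigma> R t) (c (\<sigma> ! t)) i (\<sigma> ! t) = Some e)"
  using assms by (auto simp: Let_def case_prod_unfold)

text \<open>Before its turn an element is never inserted. Controllers are drawn according to the
  initial sets, so this is what lets their law give the probability that the element survives in its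
  controlling set.\<close>

lemma mem_aw_state_unprocessed:
  assumes "e \<notin> set (take t \<sigma>)" "t \<le> length \<sigma>" "e \<in> fst (aw_state \<beta> I \<phi> c \<sigma> R t) i"
  shows "e \<in> I i"
  using assms
proof (induction t)
  case (Suc t)
  then have "e \<notin> set (take t \<sigma>)" "e \<noteq> \<sigma> ! t"
    by (auto simp: take_Suc_conv_app_nth)
  with Suc show ?case
    by (subst (asm) mem_aw_state_Suc) auto
qed simp

text \<open>The quantity \<open>y\<^sub>e\<close> of the overview; for the initial sets it equals
  \<open>x $ e\<close>.\<close>

definition coverage :: "nat \<Rightarrow> (nat \<Rightarrow> real) \<Rightarrow> (nat \<Rightarrow> 'u set) \<Rightarrow> 'u \<Rightarrow> real" where
  "coverage m \<beta> J e = (\<Sum>i=1..m. \<beta> i * of_bool (e \<in> J i))"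

definition removed_weight ::
    "nat \<Rightarrow> (nat \<Rightarrow> real) \<Rightarrow> (nat \<Rightarrow> 'u set) \<Rightarrow> (nat \<Rightarrow> 'u option) \<Rightarrow> 'u \<Rightarrow> real" where
  "removed_weight m \<beta> J r e = (\<Sum>i=1..m. \<beta> i * of_bool (e \<in> J i \<and> r i = Some e))"

lemma coverage_aw_state_Suc:
  fixes \<beta> :: "nat \<Rightarrow> real" and I :: "nat \<Rightarrow> 'u set" and \<phi> :: "'u exchange_rule"
    and c :: "'u \<Rightarrow> nat" and \<sigma> :: "'u list" and R :: "'u set" and t :: nat
  assumes "e \<noteq> \<sigma> ! t"
  defines "J \<equiv> fst (aw_state \<beta> I \<phi> c \<sigma> R t)"
  shows "coverage m \<beta> (fst (aw_state \<beta> I \<phi> c \<sigma> R (Suc t))) e = coverage m \<beta> J e -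
           (if \<sigma> ! t \<in> R \<and> \<sigma> ! t \<in> J (c (\<sigma> ! t))
            then removed_weight m \<beta> J (\<lambda>i. \<phi> (aw_history c \<sigma> R t) (c (\<sigma> ! t)) i (\<sigma> ! t)) e else 0)"
proof (cases "\<sigma> ! t \<in> R \<and> \<sigma> ! t \<in> J (c (\<sigma> ! t))")
  case True
  \<comment> \<open>Indices of weight 0 keep their sets, but they contribute 0 to both sums, so the
    condition \<open>\<beta> i \<noteq> 0\<close> of the update does not disturb the
    comparison.\<close>
  then show ?thesis
    unfolding coverage_def removed_weight_def mem_aw_state_Suc[OF assms(1)] J_def[symmetric]
      if_P[OF True] sum_subtractf[symmetric]
    by (intro sum.cong) auto
next
  case False
  then show ?thesis
    unfolding coverage_def mem_aw_state_Suc[OF assms(1)] J_def[symmetric] if_not_P[OF False]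
    by auto
qed

lemma removed_weight_nonneg: "(\<And>i. i \<in> {1..m} \<Longrightarrow> 0 \<le> \<beta> i) \<Longrightarrow> 0 \<le> removed_weight m \<beta> J r e"
  unfolding removed_weight_def by (intro sum_nonneg) auto

text \<open>Summing over \<open>e\<close> first, index \<open>i\<close> loses at most the single
  element \<open>r i\<close> and so contributes at most \<open>\<beta> i\<close>. This is the source
  of the bound on the norm of \<open>\<Delta>\<close>.\<close>

lemma sum_removed_weight_le:
  assumes "finite U" "\<And>i. i \<in> {1..m} \<Longrightarrow> 0 \<le> \<beta> i"
  shows "(\<Sum>e\<in>U. removed_weight m \<beta> J r e) \<le> (\<Sum>i=1..m. \<beta> i)"
proof -
  have "(\<Sum>e\<in>U. of_bool (e \<in> J i \<and> r i = Some e)) \<le> (1 :: real)" for i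
  proof -
    have "(\<Sum>e\<in>U. of_bool (e \<in> J i \<and> r i = Some e)) \<le> (\<Sum>e\<in>U. if r i = Some e then 1 else 0 :: real)"
      by (intro sum_mono) auto
    also have "\<dots> \<le> 1"
      using assms(1) by (cases "r i") auto
    finally show ?thesis .
  qed
  then have "(\<Sum>i=1..m. \<beta> i * (\<Sum>e\<in>U. of_bool (e \<in> J i \<and> r i = Some e))) \<le> (\<Sum>i=1..m. \<beta> i * 1)"
    using assms(2) by (intro sum_mono mult_left_mono) auto
  then show ?thesis
    unfolding removed_weight_def by (subst sum.swap) (simp add: sum_distrib_left)
qed

text \<open>The number of steps, among the first \<open>t\<close>, completed before the turn of
  \<open>e\<close>: \<open>t\<close> itself as long as \<open>e\<close> is waiting, afterwards the
  list index of \<open>e\<close>.\<close>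

definition frozen_time :: "'u \<Rightarrow> 'u list \<Rightarrow> nat \<Rightarrow> nat" where
  "frozen_time e \<sigma> t = length (takeWhile (\<lambda>a. a \<noteq> e) (take t \<sigma>))"

lemma frozen_time_le: "frozen_time e \<sigma> t \<le> t"
  unfolding frozen_time_def by (metis length_takeWhile_le length_take min.bounded_iff)

lemma frozen_time_unprocessed: "e \<notin> set (take t \<sigma>) \<Longrightarrow> t \<le> length \<sigma> \<Longrightarrow> frozen_time e \<sigma> t = t"
  unfolding frozen_time_def by (subst takeWhile_eq_all_conv[THEN iffD2]) auto

lemma frozen_time_Suc:
  assumes "t < length \<sigma>"
  shows "frozen_time e \<sigma> (Suc t) = (if e \<in> set (take (Suc t) \<sigma>) then frozen_time e \<sigma> t else Suc t)"
proof (cases "e \<in> set (take t \<sigma>)")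
  case True
  then show ?thesis
    using assms by (simp add: frozen_time_def take_Suc_conv_app_nth)
next
  case False
  then have "length (takeWhile (\<lambda>a. a \<noteq> e) (take t \<sigma>)) = t"
    using assms by (subst takeWhile_eq_all_conv[THEN iffD2]) auto
  with False show ?thesis
    using assms by (auto simp: frozen_time_def take_Suc_conv_app_nth takeWhile_append)
qed

lemma frozen_time_cong: "take t \<sigma> = take t \<sigma>' \<Longrightarrow> frozen_time e \<sigma> t = frozen_time e \<sigma>' t"
  by (simp add: frozen_time_def)

subsection \<open>The law of a step\<close>

locale aw_scheme =
  fixes U :: "'u::finite set"
    and k :: nat
    and \<I> :: "nat \<Rightarrow> 'u set set"
    and x :: "real ^ 'u"
    and m :: "nat \<Rightarrow> nat"
    and \<beta> :: "nat \<Rightarrow> nat \<Rightarrow> real"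
    and I :: "nat \<Rightarrow> nat \<Rightarrow> 'u set"
    and \<phi> :: "nat \<Rightarrow> 'u exchange_rule"
  assumes k_pos: "k \<ge> 1"
    and decomposition: "\<And>j. j \<in> {1..k} \<Longrightarrow> convex_decomposition U (\<I> j) x (m j) (\<beta> j) (I j)"
    and exchange: "\<And>j. j \<in> {1..k} \<Longrightarrow>
           maintains_exchange_mappings U (\<I> j) x (m j) (\<beta> j) (I j) (\<phi> j)"
begin

abbreviation "P \<equiv> aw_pmf k U x m \<beta> I"
abbreviation "n \<equiv> card U"

text \<open>The dummy index 0 of elements with \<open>x $ e = 0\<close> becomes a point mass, so
  that the controllers for one matroid form a product over all of \<open>U\<close>.\<close>

definition ctrl :: "nat \<Rightarrow> 'u \<Rightarrow> nat pmf" where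
  "ctrl j e = (if 0 < x $ e then controller_pmf x (m j) (\<beta> j) (I j) e else return_pmf 0)"

text \<open>Outcomes group controllers by matroid, but a step reveals the controllers of one element
  for all matroids; this is the law of that transposed function.\<close>

definition ctrls :: "'u \<Rightarrow> (nat \<Rightarrow> nat) pmf" where
  "ctrls e = Pi_pmf {1..k} 0 (\<lambda>j. ctrl j e)"

text \<open>Here \<open>t\<close> counts completed steps, so the record belongs to step number
  \<open>Suc t\<close>: it is the entry appended to the joint history.\<close>

definition step_record :: "nat \<Rightarrow> 'u aw_outcome \<Rightarrow> 'u \<times> bool \<times> (nat \<Rightarrow> nat)" where
  "step_record t = (\<lambda>(c, \<sigma>, R). (\<sigma> ! t, \<sigma> ! t \<in> R, \<lambda>j. c j (\<sigma> ! t)))"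

text \<open>The law of a step after the elements of \<open>A\<close> have been processed, nested in
  the order of revelation so that \<open>map_pmf_given_chain\<close> can peel off one draw at a
  time.\<close>

definition step_pmf :: "'u set \<Rightarrow> ('u \<times> bool \<times> (nat \<Rightarrow> nat)) pmf" where
  "step_pmf A = bind_pmf (pmf_of_set (U - A)) (\<lambda>e. map_pmf (Pair e)
     (bind_pmf (bernoulli_pmf (x $ e)) (\<lambda>b. map_pmf (Pair b) (ctrls e))))"

lemma controllers_pmf_eq: "controllers_pmf U x (m j) (\<beta> j) (I j) = Pi_pmf U 0 (ctrl j)"
  unfolding controllers_pmf_def ctrl_def by (rule Pi_pmf_if_set[symmetric]) simp

lemma set_pmf_aw:
  assumes "(c, \<sigma>, R) \<in> set_pmf P"
  shows "j \<in> {1..k} \<Longrightarrow> c j \<in> set_pmf (controllers_pmf U x (m j) (\<beta> j) (I j))"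
    and "j \<notin> {1..k} \<Longrightarrow> c j = (\<lambda>_. 0)"
    and "\<sigma> \<in> permutations_of_set U"
    and "R \<in> set_pmf (random_set_pmf U x)"
  using assms unfolding aw_pmf_def by (auto simp: set_Pi_pmf PiE_dflt_def)

lemma set_pmf_aw_order:
  assumes "(c, \<sigma>, R) \<in> set_pmf P"
  shows "distinct \<sigma>" "set \<sigma> = U" "length \<sigma> = n"
  using set_pmf_aw(3)[OF assms] by (auto simp: permutations_of_set_def distinct_card[symmetric])

lemma prob_random_set_cylinder:
  assumes "A \<subseteq> U"
  shows "measure_pmf.prob (random_set_pmf U x) {R. \<forall>e\<in>A. e \<in> R \<longleftrightarrow> b e}
           = (\<Prod>e\<in>A. pmf (bernoulli_pmf (x $ e)) (b e))"
proof -
  have "measure_pmf.prob (random_set_pmf U x) {R. \<forall>e\<in>A. e \<in> R \<longleftrightarrow> b e}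
      = measure_pmf.prob (Pi_pmf U False (\<lambda>e. bernoulli_pmf (x $ e))) {f. \<forall>e\<in>A. f e = b e}"
    unfolding random_set_pmf_def measure_map_pmf using assms
    by (intro arg_cong2[where f = measure]) auto
  also have "\<dots> = (\<Prod>e\<in>A. pmf (bernoulli_pmf (x $ e)) (b e))"
    using assms by (subst prob_Pi_pmf_cylinder) (auto intro!: prod.cong)
  finally show ?thesis .
qed

lemma prob_controllers_cylinder:
  assumes "A \<subseteq> U"
  shows "measure_pmf.prob (Pi_pmf {1..k} (\<lambda>_. 0) (\<lambda>j. controllers_pmf U x (m j) (\<beta> j) (I j)))
             {c. \<forall>j\<in>{1..k}. \<forall>e\<in>A. c j e = g j e}
           = (\<Prod>e\<in>A. \<Prod>j=1..k. pmf (ctrl j e) (g j e))"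
proof -
  have "{c. \<forall>j\<in>{1..k}. \<forall>e\<in>A. c j e = g j e} = Pi {1..k} (\<lambda>j. {f. \<forall>e\<in>A. f e = g j e})"
    by (auto simp: Pi_def)
  moreover have "measure_pmf.prob (controllers_pmf U x (m j) (\<beta> j) (I j)) {f. \<forall>e\<in>A. f e = g j e}
      = (\<Prod>e\<in>A. pmf (ctrl j e) (g j e))" for j
    unfolding controllers_pmf_eq using assms
    by (subst prob_Pi_pmf_cylinder) (auto intro!: prod.cong)
  ultimately show ?thesis
    by (simp add: measure_Pi_pmf_Pi prod.swap[of _ A])
qed

lemma prob_order_prefix:
  assumes "\<sigma> \<in> permutations_of_set U" "t \<le> n"
  shows "measure_pmf.prob (pmf_of_set (permutations_of_set U)) {\<sigma>'. take t \<sigma>' = take t \<sigma>}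
           = fact (n - t) / fact n"
proof -
  have *: "distinct \<sigma>" "set \<sigma> = U" "length \<sigma> = n"
    using assms by (auto simp: permutations_of_set_def distinct_card[symmetric])
  have "permutations_of_set U \<inter> {\<sigma>'. take t \<sigma>' = take t \<sigma>}
      = {\<sigma>'\<in>permutations_of_set U. take (length (take t \<sigma>)) \<sigma>' = take t \<sigma>}"
    using * assms by auto
  also have "card \<dots> = fact (n - t)"
    using * assms by (subst card_permutations_of_set_prefix) (auto dest: in_set_takeD)
  finally show ?thesis
    by (simp add: measure_pmf_of_set)
qed

text \<open>Up to null outcomes, repeating a history means hitting cylinder events in the three
  independent components: controllers, order and random set. Hence each processed element
  contributes its own factor.\<close>

lemma prob_history:
  assumes "(c, \<sigma>, R) \<in> set_pmf P" "t \<le> n"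
  shows "measure_pmf.prob P {\<omega>. aw_joint_history t \<omega> = aw_joint_history t (c, \<sigma>, R)}
           = fact (n - t) / fact n *
             (\<Prod>e\<in>set (take t \<sigma>). pmf (bernoulli_pmf (x $ e)) (e \<in> R) *
                (\<Prod>j=1..k. pmf (ctrl j e) (c j e)))"
proof -
  let ?A = "set (take t \<sigma>)"
  have "set \<sigma> = U"
    using set_pmf_aw_order[OF assms(1)] by simp
  then have A: "?A \<subseteq> U"
    by (meson set_take_subset subset_trans)
  let ?C = "{c'. \<forall>j\<in>{1..k}. \<forall>e\<in>?A. c' j e = c j e}"
  let ?O = "{\<sigma>'. take t \<sigma>' = take t \<sigma>}"
  let ?R = "{R'. \<forall>e\<in>?A. e \<in> R' \<longleftrightarrow> e \<in> R}"
  have "measure_pmf.prob P {\<omega>. aw_joint_history t \<omega> = aw_joint_history t (c, \<sigma>, R)}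
      = measure_pmf.prob P (?C \<times> ?O \<times> ?R)"
  proof (rule prob_cong_support, clarify)
    fix c' \<sigma>' R'
    assume *: "(c', \<sigma>', R') \<in> set_pmf P"
    have "take t \<sigma>' = take t \<sigma>" if "aw_joint_history t (c', \<sigma>', R') = aw_joint_history t (c, \<sigma>, R)"
      using arg_cong[OF that, of "map fst"] by (simp add: aw_joint_history_def o_def)
    \<comment> \<open>Histories record controllers at all indices \<open>j\<close>, but outside
      \<open>{1..k}\<close> these are constantly 0 on the support.\<close>
    moreover have "c' j = c j" if "j \<notin> {1..k}" for j
      using set_pmf_aw(2)[OF * that] set_pmf_aw(2)[OF assms(1) that] by simp
    ultimately show "(c', \<sigma>', R') \<in> {\<omega>. aw_joint_history t \<omega> = aw_joint_history t (c, \<sigma>, R)}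
        \<longleftrightarrow> (c', \<sigma>', R') \<in> ?C \<times> ?O \<times> ?R"
      by (auto simp: aw_joint_history_def fun_eq_iff) (metis (full_types) atLeastAtMost_iff)
  qed
  also have "\<dots> = (\<Prod>e\<in>?A. \<Prod>j=1..k. pmf (ctrl j e) (c j e)) *
      (fact (n - t) / fact n * (\<Prod>e\<in>?A. pmf (bernoulli_pmf (x $ e)) (e \<in> R)))"
    unfolding aw_pmf_def prob_pair_pmf_Times
    using prob_order_prefix[OF set_pmf_aw(3)[OF assms(1)] assms(2)]
      prob_controllers_cylinder[OF A, of c] prob_random_set_cylinder[OF A, of "\<lambda>e. e \<in> R"]
    by simp
  finally show ?thesis
    by (simp add: prod.distrib)
qed

lemma aw_joint_history_Suc:
  assumes "\<omega> \<in> set_pmf P" "t < n"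
  shows "aw_joint_history (Suc t) \<omega> = aw_joint_history t \<omega> @ [step_record t \<omega>]"
  using assms set_pmf_aw_order(3)[of "fst \<omega>" "fst (snd \<omega>)" "snd (snd \<omega>)"]
  by (auto simp: aw_joint_history_def step_record_def take_Suc_conv_app_nth split: prod.splits)

lemma pmf_step_pmf:
  assumes "A \<subseteq> U" "e \<in> U - A" "\<And>j. j \<notin> {1..k} \<Longrightarrow> g j = 0"
  shows "pmf (step_pmf A) (e, b, g)
           = 1 / card (U - A) * (pmf (bernoulli_pmf (x $ e)) b * (\<Prod>j=1..k. pmf (ctrl j e) (g j)))"
proof -
  have "pmf (ctrls e) g = (\<Prod>j=1..k. pmf (ctrl j e) (g j))"
    unfolding ctrls_def using assms(3) by (intro pmf_Pi') auto
  moreover have "pmf (pmf_of_set (U - A)) e = 1 / card (U - A)"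
    using assms(2) by (subst pmf_of_set) auto
  ultimately show ?thesis
    unfolding step_pmf_def pmf_bind_Pair by simp
qed

text \<open>The conditional probability is the quotient of the probabilities of two consecutive
  histories. The factors of earlier elements cancel, leaving that of the new element and a quotient
  of factorials.\<close>

lemma step_record_law:
  assumes "(c, \<sigma>, R) \<in> set_pmf P" "t < n"
  shows "map_pmf (step_record t) (given P (aw_joint_history t) (c, \<sigma>, R)) = step_pmf (set (take t \<sigma>))"
proof (rule map_pmf_given_eqI[OF assms(1)], clarify)
  fix c' :: "nat \<Rightarrow> 'u \<Rightarrow> nat" and \<sigma>' :: "'u list" and R' :: "'u set"
  let ?\<omega> = "(c, \<sigma>, R)" and ?\<omega>' = "(c', \<sigma>', R')"
  assume \<omega>': "?\<omega>' \<in> set_pmf P" and eq: "aw_joint_history t ?\<omega>' = aw_joint_history t ?\<omega>"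
  let ?A = "set (take t \<sigma>')" and ?e = "\<sigma>' ! t"
  note order = set_pmf_aw_order[OF \<omega>']
  have A: "set (take t \<sigma>) = ?A"
    using arg_cong[OF eq, of "map fst"] by (simp add: aw_joint_history_def o_def)
  have e: "?e \<in> U - ?A"
    using order assms(2) by (auto simp: in_set_conv_nth nth_eq_iff_index_eq)
  have AU: "?A \<subseteq> U"
    using order by (metis set_take_subset)
  have card_rest: "card (U - ?A) = n - t"
    using AU order assms(2) by (simp add: card_Diff_subset distinct_card)
  have A_Suc: "set (take (Suc t) \<sigma>') = insert ?e ?A"
    using order assms(2) by (simp add: take_Suc_conv_app_nth)
  \<comment> \<open>The quotient of factorials contributes \<open>1 / (n - t)\<close>, the uniform
    choice among the unprocessed elements.\<close>
  have "(fact (n - t) :: real) = real (n - t) * fact (n - Suc t)"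
    using assms(2) by (subst fact_reduce) auto
  then have fact_eq: "(fact (n - Suc t) :: real) = fact (n - t) / real (n - t)"
    using assms(2) by simp
  have zero: "c' j ?e = 0" if "j \<notin> {1..k}" for j
    using set_pmf_aw(2)[OF \<omega>' that] by simp
  have "measure_pmf.prob P {\<omega>. step_record t \<omega> = step_record t ?\<omega>' \<and>
          aw_joint_history t \<omega> = aw_joint_history t ?\<omega>}
      = measure_pmf.prob P {\<omega>. aw_joint_history (Suc t) \<omega> = aw_joint_history (Suc t) ?\<omega>'}"
    using \<omega>' assms(2) eq by (intro prob_cong_support) (auto simp: aw_joint_history_Suc)
  also have "\<dots> = fact (n - Suc t) / fact n *
      (\<Prod>e\<in>insert ?e ?A. pmf (bernoulli_pmf (x $ e)) (e \<in> R') * (\<Prod>j=1..k. pmf (ctrl j e) (c' j e)))"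
    using assms(2) by (simp add: prob_history[OF \<omega>'] A_Suc del: prod.insert)
  also have "\<dots> = (fact (n - t) / fact n *
      (\<Prod>e\<in>?A. pmf (bernoulli_pmf (x $ e)) (e \<in> R') * (\<Prod>j=1..k. pmf (ctrl j e) (c' j e)))) *
      (1 / real (n - t) * (pmf (bernoulli_pmf (x $ ?e)) (?e \<in> R') * (\<Prod>j=1..k. pmf (ctrl j ?e) (c' j ?e))))"
    using e unfolding fact_eq by (simp add: mult_ac)
  also have "\<dots> = measure_pmf.prob P {\<omega>. aw_joint_history t \<omega> = aw_joint_history t ?\<omega>'} *
      pmf (step_pmf ?A) (step_record t ?\<omega>')"
    using pmf_step_pmf[OF AU e, of "\<lambda>j. c' j ?e" "?e \<in> R'"] zero assms(2)
    by (simp add: prob_history[OF \<omega>'] step_record_def card_rest)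
  finally show "measure_pmf.prob P {\<omega>. step_record t \<omega> = step_record t ?\<omega>' \<and>
          aw_joint_history t \<omega> = aw_joint_history t ?\<omega>}
      = measure_pmf.prob P {\<omega>. aw_joint_history t \<omega> = aw_joint_history t ?\<omega>} *
        pmf (step_pmf (set (take t \<sigma>))) (step_record t ?\<omega>')"
    unfolding A eq .
qed

text \<open>Two rounds of the chain rule split \<open>step_pmf\<close> into its three draws:
  element, membership in \<open>R\<close>, controllers.\<close>

lemma
  assumes "\<omega> \<in> set_pmf P" "t < n"
  shows order_law: "map_pmf (\<lambda>\<omega>'. aw_order \<omega>' (Suc t)) (given P (aw_joint_history t) \<omega>)
           = pmf_of_set (U - set (take t (fst (snd \<omega>))))"
    and random_set_law: "map_pmf (\<lambda>\<omega>'. aw_order \<omega>' (Suc t) \<in> aw_random_set \<omega>')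
             (given P (\<lambda>\<omega>'. (aw_joint_history t \<omega>', aw_order \<omega>' (Suc t))) \<omega>)
           = bernoulli_pmf (x $ aw_order \<omega> (Suc t))"
    and controllers_law: "map_pmf (\<lambda>\<omega>' j. fst \<omega>' j (aw_order \<omega>' (Suc t)))
             (given P (\<lambda>\<omega>'. (aw_joint_history t \<omega>', aw_order \<omega>' (Suc t),
                aw_order \<omega>' (Suc t) \<in> aw_random_set \<omega>')) \<omega>)
           = ctrls (aw_order \<omega> (Suc t))"
proof -
  let ?e = "\<lambda>\<omega>. aw_order \<omega> (Suc t)"
  let ?b = "\<lambda>\<omega>. ?e \<omega> \<in> aw_random_set \<omega>"
  let ?g = "\<lambda>\<omega> j. fst \<omega> j (?e \<omega>)"
  have "step_record t = (\<lambda>\<omega>. (?e \<omega>, ?b \<omega>, ?g \<omega>))"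
    by (auto simp: step_record_def aw_order_def aw_random_set_def)
  then have "map_pmf (\<lambda>\<omega>. (?e \<omega>, ?b \<omega>, ?g \<omega>)) (given P (aw_joint_history t) \<omega>)
      = step_pmf (set (take t (fst (snd \<omega>))))"
    using step_record_law[of "fst \<omega>" "fst (snd \<omega>)" "snd (snd \<omega>)" t] assms by simp
  note chain = map_pmf_given_chain[OF assms(1) this[unfolded step_pmf_def]]
  show "map_pmf ?e (given P (aw_joint_history t) \<omega>) = pmf_of_set (U - set (take t (fst (snd \<omega>))))"
    by (rule chain(1))
  note chain' = map_pmf_given_chain[OF assms(1) chain(2)]
  show "map_pmf ?b (given P (\<lambda>\<omega>'. (aw_joint_history t \<omega>', ?e \<omega>')) \<omega>) = bernoulli_pmf (x $ ?e \<omega>)"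
    by (rule chain'(1))
  have "given P (\<lambda>\<omega>'. ((aw_joint_history t \<omega>', ?e \<omega>'), ?b \<omega>')) \<omega>
      = given P (\<lambda>\<omega>'. (aw_joint_history t \<omega>', ?e \<omega>', ?b \<omega>')) \<omega>"
    by (simp add: given_def)
  then show "map_pmf ?g (given P (\<lambda>\<omega>'. (aw_joint_history t \<omega>', ?e \<omega>', ?b \<omega>')) \<omega>) = ctrls (?e \<omega>)"
    using chain'(2) by simp
qed

section \<open>Weights and controller distributions\<close>

lemma
  assumes "j \<in> {1..k}"
  shows weights_nonneg: "i \<in> {1..m j} \<Longrightarrow> 0 \<le> \<beta> j i"
    and weights_sum: "(\<Sum>i=1..m j. \<beta> j i) = 1"
    and coverage_initial: "coverage (m j) (\<beta> j) (I j) e = x $ e"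
proof -
  note d = decomposition[OF assms, unfolded convex_decomposition_def]
  show "i \<in> {1..m j} \<Longrightarrow> 0 \<le> \<beta> j i" "(\<Sum>i=1..m j. \<beta> j i) = 1"
    using d by auto
  have x: "x = (\<Sum>i=1..m j. \<beta> j i *\<^sub>R indicator_vec (I j i))"
    using d by blast
  show "coverage (m j) (\<beta> j) (I j) e = x $ e"
    by (subst x) (simp add: coverage_def indicator_vec_def indicator_def)
qed

lemma coverage_nonneg: "j \<in> {1..k} \<Longrightarrow> 0 \<le> coverage (m j) (\<beta> j) J e"
  unfolding coverage_def by (intro sum_nonneg) (auto simp: weights_nonneg)

lemma coverage_le_1: 
  assumes "j \<in> {1..k}"
  shows "coverage (m j) (\<beta> j) J e \<le> 1"
proof -
  have "coverage (m j) (\<beta> j) J e \<le> (\<Sum>i=1..m j. \<beta> j i)"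
    unfolding coverage_def by (intro sum_mono) (auto simp: weights_nonneg[OF assms])
  then show ?thesis using weights_sum[OF assms] by simp
qed

lemma x_range: "0 \<le> x $ e" "x $ e \<le> 1"
  using coverage_nonneg[of 1 "I 1" e] coverage_le_1[of 1 "I 1" e] coverage_initial[of 1 e] k_pos by auto

text \<open>The weights of the initial sets containing \<open>e\<close> add up to
  \<open>x $ e\<close>. After division the total mass is 1, the condition under which
  \<open>embed_pmf\<close> has the prescribed probabilities.\<close>

lemma pmf_ctrl:
  assumes "j \<in> {1..k}" "0 < x $ e"
  shows "pmf (ctrl j e) i = (if i \<in> {1..m j} \<and> e \<in> I j i \<and> \<beta> j i \<noteq> 0 then \<beta> j i / x $ e else 0)"
proof -
  let ?f = "\<lambda>i. if i \<in> {1..m j} \<and> e \<in> I j i \<and> \<beta> j i \<noteq> 0 then \<beta> j i / x $ e else 0"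
  have nonneg: "0 \<le> ?f i" for i
    using weights_nonneg[OF assms(1)] x_range by auto
  have "(\<integral>\<^sup>+i. ennreal (?f i) \<partial>count_space UNIV) = (\<integral>\<^sup>+i. ennreal (?f i) \<partial>count_space {1..m j})"
    by (intro nn_integral_count_space_eq) auto
  also have "\<dots> = ennreal (\<Sum>i=1..m j. ?f i)"
    by (subst nn_integral_count_space_finite) (simp, rule sum_ennreal, rule nonneg)
  also have "(\<Sum>i=1..m j. ?f i) = coverage (m j) (\<beta> j) (I j) e / x $ e"
    unfolding coverage_def sum_divide_distrib by (intro sum.cong) auto
  also have "\<dots> = 1"
    using assms coverage_initial by simp
  finally have "(\<integral>\<^sup>+i. ennreal (?f i) \<partial>count_space UNIV) = 1"
    by simp
  with nonneg have "pmf (embed_pmf ?f) i = ?f i"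
    by (rule pmf_embed_pmf)
  then show ?thesis
    unfolding ctrl_def controller_pmf_def if_P[OF assms(2)] .
qed

lemma set_pmf_ctrl:
  assumes "j \<in> {1..k}" "0 < x $ e"
  shows "set_pmf (ctrl j e) \<subseteq> {1..m j}"
  by (auto simp: set_pmf_iff pmf_ctrl[OF assms] split: if_splits)

text \<open>The survival probability \<open>y\<^sub>e / x\<^sub>e\<close>: as every current set with
  \<open>e\<close> contained it initially, each one is selected with its full probability
  \<open>\<beta> j i / x $ e\<close>.\<close>

lemma prob_ctrl:
  assumes "j \<in> {1..k}" "0 < x $ e" "\<And>i. e \<in> J i \<Longrightarrow> e \<in> I j i"
  shows "measure_pmf.prob (ctrl j e) {i. e \<in> J i} = coverage (m j) (\<beta> j) J e / x $ e"
proof -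
  have "measure_pmf.prob (ctrl j e) {i. e \<in> J i} = measure_pmf.prob (ctrl j e) {i\<in>{1..m j}. e \<in> J i}"
    using set_pmf_ctrl[OF assms(1,2)] by (intro prob_cong_support) auto
  also have "\<dots> = (\<Sum>i\<in>{i\<in>{1..m j}. e \<in> J i}. \<beta> j i / x $ e)"
    using assms by (subst measure_measure_pmf_finite) (auto simp: pmf_ctrl intro!: sum.cong)
  also have "\<dots> = coverage (m j) (\<beta> j) J e / x $ e"
    unfolding coverage_def sum_divide_distrib by (subst sum.inter_filter) (auto intro!: sum.cong)
  finally show ?thesis .
qed

lemma prob_ctrls:
  "measure_pmf.prob (ctrls e) {g. \<forall>j\<in>{1..k}. Q j (g j)} = (\<Prod>j=1..k. measure_pmf.prob (ctrl j e) {i. Q j i})"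
proof -
  have "{g. \<forall>j\<in>{1..k}. Q j (g j)} = Pi {1..k} (\<lambda>j. {i. Q j i})"
    by (auto simp: Pi_def)
  then show ?thesis
    by (simp add: ctrls_def measure_Pi_pmf_Pi)
qed

text \<open>For a fixed target set, \<open>Q i f\<close> will say that \<open>f\<close> lies in the
  set with index \<open>i\<close> and is mapped to \<open>e\<close>. Each \<open>i\<close> admits at
  most one such \<open>f\<close>, and this \<open>f\<close> is drawn, lies in \<open>R\<close> and
  has controller \<open>i\<close> with probability at most
  \<open>\<beta> j i / card (U - A)\<close>; the weights sum to 1.\<close>

lemma prob_step_exchange:
  assumes j: "j \<in> {1..k}" and A: "A \<subset> U"
    and unique: "\<And>i f f'. i \<in> {1..m j} \<Longrightarrow> Q i f \<Longrightarrow> Q i f' \<Longrightarrow> f = f'"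
  shows "measure_pmf.prob (step_pmf A) {(f, b, g). b \<and> Q (g j) f} \<le> 1 / card (U - A)"
proof -
  define M where "M = bind_pmf (pmf_of_set (U - A)) (\<lambda>e. map_pmf (Pair e)
     (bind_pmf (bernoulli_pmf (x $ e)) (\<lambda>b. map_pmf (Pair b) (ctrl j e))))"
  have "ctrl j e = map_pmf (\<lambda>g. g j) (ctrls e)" for e
    using j unfolding ctrls_def by (subst Pi_pmf_component) auto
  then have M_eq: "map_pmf (\<lambda>(f, b, g). (f, b, g j)) (step_pmf A) = M"
    unfolding M_def step_pmf_def
    by (simp add: map_bind_pmf pmf.map_comp o_def)
  have ne: "U - A \<noteq> {}" and fin: "finite (U - A)"
    using A by auto
  have pmf_M: "pmf M (f, True, i) = indicator (U - A) f / card (U - A) * (x $ f * pmf (ctrl j f) i)" for f i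
    unfolding M_def pmf_bind_Pair using ne fin x_range by simp
  have pmf_M_le: "pmf M (f, True, i) \<le> \<beta> j i / card (U - A)" if "i \<in> {1..m j}" for f i
  proof -
    \<comment> \<open>The probability \<open>x $ f\<close> of lying in \<open>R\<close> cancels the
      denominator of the controller probability; if \<open>x $ f = 0\<close>, the product is
      0.\<close>
    have "x $ f * pmf (ctrl j f) i \<le> \<beta> j i"
      using pmf_ctrl[OF j, of f i] weights_nonneg[OF j that] x_range(1)[of f]
      by (cases "0 < x $ f") auto
    then have "indicator (U - A) f * (x $ f * pmf (ctrl j f) i) \<le> \<beta> j i"
      using weights_nonneg[OF j that] by (auto simp: indicator_def)
    then show ?thesis
      unfolding pmf_M by (simp add: divide_right_mono)
  qed
  have supp_M: "f \<in> U - A \<and> i \<in> {1..m j}" if "(f, True, i) \<in> set_pmf M" for f i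
  proof -
    have *: "indicator (U - A) f / card (U - A) * (x $ f * pmf (ctrl j f) i) \<noteq> (0::real)"
      using that by (simp add: set_pmf_iff pmf_M)
    then have "x $ f \<noteq> 0" "f \<in> U - A" "i \<in> set_pmf (ctrl j f)"
      by (auto simp: set_pmf_iff indicator_def)
    with set_pmf_ctrl[OF j, of f] x_range(1)[of f] show ?thesis
      by auto
  qed
  \<comment> \<open>Restricted to the support the event is finite, and by uniqueness the index
    \<open>i\<close> determines the whole triple.\<close>
  define S where "S = {(f, b, i). b \<and> Q i f \<and> f \<in> U - A \<and> i \<in> {1..m j}}"
  have finS: "finite S"
    by (rule finite_subset[of _ "(U - A) \<times> UNIV \<times> {1..m j}"]) (auto simp: S_def)
  have injS: "inj_on (\<lambda>(f, b, i). i) S"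
    by (auto simp: inj_on_def S_def intro: unique)
  have "measure_pmf.prob (step_pmf A) {(f, b, g). b \<and> Q (g j) f} = measure_pmf.prob M {(f, b, i). b \<and> Q i f}"
    unfolding M_eq[symmetric] measure_map_pmf by (intro arg_cong2[where f = measure]) auto
  also have "\<dots> = measure_pmf.prob M S"
    using supp_M by (intro prob_cong_support) (fastforce simp: S_def)
  also have "\<dots> = (\<Sum>z\<in>S. pmf M z)"
    using finS by (rule measure_measure_pmf_finite)
  also have "\<dots> \<le> (\<Sum>z\<in>S. (\<lambda>i. \<beta> j i / card (U - A)) ((\<lambda>(f, b, i). i) z))"
    using pmf_M_le by (intro sum_mono) (auto simp: S_def)
  also have "\<dots> = (\<Sum>i\<in>(\<lambda>(f, b, i). i) ` S. \<beta> j i / card (U - A))"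
    using sum.reindex[OF injS, of "\<lambda>i. \<beta> j i / card (U - A)"] by (simp add: o_def)
  also have "\<dots> \<le> (\<Sum>i=1..m j. \<beta> j i / card (U - A))"
    by (intro sum_mono2) (auto simp: S_def weights_nonneg[OF j])
  also have "\<dots> = 1 / card (U - A)"
    unfolding sum_divide_distrib[symmetric] weights_sum[OF j] ..
  finally show ?thesis .
qed

subsection \<open>The sequential selection process\<close>

definition current_set :: "nat \<Rightarrow> nat \<Rightarrow> 'u aw_outcome \<Rightarrow> nat \<Rightarrow> 'u set" where
  "current_set j t = (\<lambda>(c, \<sigma>, R). fst (aw_state (\<beta> j) (I j) (\<phi> j) (c j) \<sigma> R t))"

definition run_history :: "nat \<Rightarrow> nat \<Rightarrow> 'u aw_outcome \<Rightarrow> 'u aw_hist" where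
  "run_history j t = (\<lambda>(c, \<sigma>, R). aw_history (c j) \<sigma> R t)"

definition processed :: "nat \<Rightarrow> 'u aw_outcome \<Rightarrow> 'u set" where
  "processed t = (\<lambda>(c, \<sigma>, R). set (take t \<sigma>))"

text \<open>Freezing at the processing time of \<open>e\<close> makes \<open>\<Delta>\<close> vanish on processed elements.\<close>

definition frozen_coverage :: "nat \<Rightarrow> 'u \<Rightarrow> nat \<Rightarrow> 'u aw_outcome \<Rightarrow> real" where
  "frozen_coverage j e t \<omega> = coverage (m j) (\<beta> j) (current_set j (frozen_time e (fst (snd \<omega>)) t) \<omega>) e"

text \<open>The decrease of \<open>frozen_coverage\<close> in step number \<open>Suc t\<close>.
  Testing \<open>processed (Suc t)\<close> rather than \<open>processed t\<close> makes it 0 also in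
  the step of \<open>e\<close> itself.\<close>

definition coverage_drop :: "nat \<Rightarrow> 'u \<Rightarrow> nat \<Rightarrow> 'u aw_outcome \<Rightarrow> real" where
  "coverage_drop j e t \<omega> =
     (let f = aw_order \<omega> (Suc t); i = fst \<omega> j f
      in if e \<notin> processed (Suc t) \<omega> \<and> f \<in> aw_random_set \<omega> \<and> f \<in> current_set j t \<omega> i
         then removed_weight (m j) (\<beta> j) (current_set j t \<omega>) (\<lambda>i'. \<phi> j (run_history j t \<omega>) i i' f) e else 0)"

text \<open>\<open>p t\<close> belongs to the state after \<open>t - 1\<close> completed steps. The
  positive part is taken because the losses in several matroids may together exceed
  \<open>x $ e\<close>.\<close>

definition p :: "nat \<Rightarrow> 'u aw_outcome \<Rightarrow> real ^ 'u" where
  "p t \<omega> = (\<chi> e. max 0 (x $ e - (\<Sum>j=1..k. x $ e - frozen_coverage j e (t - 1) \<omega>)))"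

text \<open>The recursion for \<open>p\<close> thus holds by definition, and what needs proof is the
  range of \<open>\<Delta>\<close>.\<close>

definition \<Delta> :: "nat \<Rightarrow> 'u aw_outcome \<Rightarrow> real ^ 'u" where
  "\<Delta> t \<omega> = p t \<omega> - p (t + 1) \<omega>"

lemma processed_Suc:
  assumes "\<omega> \<in> set_pmf P" "t < n"
  shows "processed (Suc t) \<omega> = insert (aw_order \<omega> (Suc t)) (processed t \<omega>)"
    and "aw_order \<omega> (Suc t) \<in> U - processed t \<omega>"
proof -
  obtain c \<sigma> R where \<omega>: "\<omega> = (c, \<sigma>, R)" by (cases \<omega>)
  note order = set_pmf_aw_order[OF assms(1)[unfolded \<omega>]]
  show "processed (Suc t) \<omega> = insert (aw_order \<omega> (Suc t)) (processed t \<omega>)"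
    using order assms(2) by (simp add: \<omega> processed_def aw_order_def take_Suc_conv_app_nth)
  show "aw_order \<omega> (Suc t) \<in> U - processed t \<omega>"
    using order assms(2) by (auto simp: \<omega> processed_def aw_order_def in_set_conv_nth nth_eq_iff_index_eq)
qed

lemma processed_subset: "\<omega> \<in> set_pmf P \<Longrightarrow> processed t \<omega> \<subseteq> U"
  using set_pmf_aw_order(2)[of "fst \<omega>" "fst (snd \<omega>)" "snd (snd \<omega>)"]
  by (auto simp: processed_def split: prod.splits dest: in_set_takeD)

lemma card_unprocessed:
  assumes "\<omega> \<in> set_pmf P" "t \<le> n"
  shows "card (U - processed t \<omega>) = n - t"
proof -
  obtain c \<sigma> R where \<omega>: "\<omega> = (c, \<sigma>, R)" by (cases \<omega>)
  note order = set_pmf_aw_order[OF assms(1)[unfolded \<omega>]]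
  then show ?thesis
    using assms(2) processed_subset[OF assms(1), of t]
    by (simp add: \<omega> processed_def card_Diff_subset distinct_card)
qed

lemma frozen_coverage_unprocessed:
  assumes "\<omega> \<in> set_pmf P" "t \<le> n" "e \<notin> processed t \<omega>"
  shows "frozen_coverage j e t \<omega> = coverage (m j) (\<beta> j) (current_set j t \<omega>) e"
proof -
  obtain c \<sigma> R where \<omega>: "\<omega> = (c, \<sigma>, R)" by (cases \<omega>)
  note order = set_pmf_aw_order[OF assms(1)[unfolded \<omega>]]
  show ?thesis
    using assms order by (simp add: \<omega> frozen_coverage_def processed_def frozen_time_unprocessed)
qed

text \<open>If \<open>e\<close> has been processed by the end of the step, its freezing time no
  longer moves and the drop is 0; otherwise this is \<open>coverage_aw_state_Suc\<close>.\<close>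

lemma frozen_coverage_Suc:
  assumes "\<omega> \<in> set_pmf P" "t < n"
  shows "frozen_coverage j e (Suc t) \<omega> = frozen_coverage j e t \<omega> - coverage_drop j e t \<omega>"
proof (cases "e \<in> processed (Suc t) \<omega>")
  case True
  then show ?thesis
    using assms set_pmf_aw_order(3)[of "fst \<omega>" "fst (snd \<omega>)" "snd (snd \<omega>)"]
    by (auto simp: frozen_coverage_def coverage_drop_def frozen_time_Suc processed_def split: prod.splits)
next
  case False
  then have e: "e \<notin> processed t \<omega>" "e \<noteq> aw_order \<omega> (Suc t)"
    using processed_Suc[OF assms] by auto
  obtain c \<sigma> R where \<omega>: "\<omega> = (c, \<sigma>, R)" by (cases \<omega>)
  have "e \<noteq> \<sigma> ! t"
    using e(2) by (simp add: \<omega> aw_order_def)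
  from coverage_aw_state_Suc[OF this, of "m j" "\<beta> j" "I j" "\<phi> j" "c j" R] False e show ?thesis
    using assms
    by (simp add: frozen_coverage_unprocessed coverage_drop_def Let_def del: aw_state.simps)
       (simp add: \<omega> current_set_def run_history_def aw_order_def aw_random_set_def del: aw_state.simps)
qed

lemma frozen_coverage_0: "j \<in> {1..k} \<Longrightarrow> frozen_coverage j e 0 \<omega> = x $ e"
  by (simp add: frozen_coverage_def frozen_time_def current_set_def coverage_initial split: prod.splits)

lemma coverage_drop_nonneg: "j \<in> {1..k} \<Longrightarrow> 0 \<le> coverage_drop j e t \<omega>"
  by (auto simp: coverage_drop_def Let_def intro!: removed_weight_nonneg weights_nonneg)

lemma frozen_coverage_le:
  assumes "j \<in> {1..k}" "\<omega> \<in> set_pmf P" "t \<le> n"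
  shows "frozen_coverage j e t \<omega> \<le> x $ e"
  using assms(3)
proof (induction t)
  case 0
  then show ?case using frozen_coverage_0[OF assms(1)] by simp
next
  case (Suc t)
  then show ?case
    using frozen_coverage_Suc[OF assms(2), of t j e] coverage_drop_nonneg[OF assms(1), of e t \<omega>] by simp
qed

section \<open>The vectors \<open>p\<close> and \<open>\<Delta>\<close>\<close>

lemma p_le:
  assumes "\<omega> \<in> set_pmf P" "t \<le> n"
  shows "p (Suc t) \<omega> $ e \<le> x $ e"
proof -
  have "0 \<le> (\<Sum>j=1..k. x $ e - frozen_coverage j e t \<omega>)"
    using assms by (intro sum_nonneg) (auto intro: frozen_coverage_le)
  then show ?thesis
    using x_range(1)[of e] by (simp add: p_def)
qed

lemma p_Suc_Suc:
  assumes "\<omega> \<in> set_pmf P" "t < n"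
  shows "p (Suc (Suc t)) \<omega> $ e = max 0 (x $ e - (\<Sum>j=1..k. x $ e - frozen_coverage j e t \<omega>)
           - (\<Sum>j=1..k. coverage_drop j e t \<omega>))"
  unfolding p_def by (simp add: frozen_coverage_Suc[OF assms] sum_subtractf sum.distrib)

text \<open>The positive part is monotone and 1-Lipschitz, so a nonnegative total drop lowers
  \<open>p\<close> by at least 0 and by no more than that drop.\<close>

lemma \<Delta>_bounds:
  assumes "\<omega> \<in> set_pmf P" "t < n"
  shows "0 \<le> \<Delta> (Suc t) \<omega> $ e"
    and "\<Delta> (Suc t) \<omega> $ e \<le> p (Suc t) \<omega> $ e"
    and "\<Delta> (Suc t) \<omega> $ e \<le> 1"
    and "\<Delta> (Suc t) \<omega> $ e \<le> (\<Sum>j=1..k. coverage_drop j e t \<omega>)"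
proof -
  have drop: "0 \<le> (\<Sum>j=1..k. coverage_drop j e t \<omega>)"
    by (intro sum_nonneg coverage_drop_nonneg)
  have eq: "\<Delta> (Suc t) \<omega> $ e = max 0 (x $ e - (\<Sum>j=1..k. x $ e - frozen_coverage j e t \<omega>)) -
      max 0 (x $ e - (\<Sum>j=1..k. x $ e - frozen_coverage j e t \<omega>)
           - (\<Sum>j=1..k. coverage_drop j e t \<omega>))"
    using p_Suc_Suc[OF assms, of e] unfolding \<Delta>_def by (simp add: p_def)
  show "0 \<le> \<Delta> (Suc t) \<omega> $ e" "\<Delta> (Suc t) \<omega> $ e \<le> (\<Sum>j=1..k. coverage_drop j e t \<omega>)"
    unfolding eq using drop by auto
  show le: "\<Delta> (Suc t) \<omega> $ e \<le> p (Suc t) \<omega> $ e"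
    unfolding eq by (simp add: p_def)
  show "\<Delta> (Suc t) \<omega> $ e \<le> 1"
    using le p_le[OF assms(1), of t e] assms(2) x_range(2)[of e] by simp
qed

text \<open>All these quantities can be read off from the joint history. For
  \<open>frozen_coverage\<close>, the freezing time depends on the order prefix and is at most
  \<open>t\<close>, so the sets at that time are fixed too.\<close>

lemma
  assumes "\<omega> \<in> set_pmf P" "\<omega>' \<in> set_pmf P" "t \<le> n"
    and eq: "aw_joint_history t \<omega> = aw_joint_history t \<omega>'"
  shows run_history_cong: "s \<le> t \<Longrightarrow> run_history j s \<omega> = run_history j s \<omega>'"
    and current_set_cong: "s \<le> t \<Longrightarrow> current_set j s \<omega> = current_set j s \<omega>'"
    and processed_cong: "processed t \<omega> = processed t \<omega>'"
    and frozen_coverage_cong: "frozen_coverage j e t \<omega> = frozen_coverage j e t \<omega>'"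
proof -
  obtain c \<sigma> R where \<omega>: "\<omega> = (c, \<sigma>, R)" by (cases \<omega>)
  obtain c' \<sigma>' R' where \<omega>': "\<omega>' = (c', \<sigma>', R')" by (cases \<omega>')
  have len: "length \<sigma> = n" "length \<sigma>' = n"
    using assms(1,2) unfolding \<omega> \<omega>' by (auto dest: set_pmf_aw_order(3))
  have "run_history j s \<omega> = map (\<lambda>(e, b, g). (e, b, g j)) (take s (aw_joint_history t \<omega>))" if "s \<le> t" for s j \<omega>
    using that by (auto simp: run_history_def aw_history_def aw_joint_history_def take_map min_def split: prod.splits)
  then show run_history: "run_history j s \<omega> = run_history j s \<omega>'" if "s \<le> t" for s j
    using eq that by simp
  show current_set: "current_set j s \<omega> = current_set j s \<omega>'" if "s \<le> t" for s j
    using run_history[OF that, of j] that assms(3) len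
    by (auto simp: current_set_def run_history_def \<omega> \<omega>' intro!: arg_cong[of _ _ fst] aw_state_cong)
  have take: "take t \<sigma> = take t \<sigma>'"
    using arg_cong[OF eq, of "map fst"] by (simp add: \<omega> \<omega>' aw_joint_history_def o_def)
  then show "processed t \<omega> = processed t \<omega>'"
    by (simp add: \<omega> \<omega>' processed_def)
  show "frozen_coverage j e t \<omega> = frozen_coverage j e t \<omega>'"
    using frozen_time_cong[OF take, of e] current_set[OF frozen_time_le[of e \<sigma> t], of j]
    by (simp add: frozen_coverage_def \<omega> \<omega>')
qed

lemma aw_joint_history_mono:
  fixes \<omega> \<omega>' :: "'u aw_outcome"
  assumes "aw_joint_history t \<omega> = aw_joint_history t \<omega>'" "s \<le> t"
  shows "aw_joint_history s \<omega> = aw_joint_history s \<omega>'"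
proof -
  have "aw_joint_history s \<omega> = take s (aw_joint_history t \<omega>)" for \<omega> :: "'u aw_outcome"
    using assms(2) by (auto simp: aw_joint_history_def take_map min_def split: prod.splits)
  then show ?thesis using assms(1) by simp
qed

text \<open>Each element is processed exactly once, so its own step alone decides about the output,
  in every matroid separately.\<close>

lemma mem_aw_output:
  assumes "\<omega> \<in> set_pmf P" "t < n"
  defines "e \<equiv> aw_order \<omega> (Suc t)"
  shows "e \<in> aw_output k U \<beta> I \<phi> \<omega> \<longleftrightarrow> e \<in> aw_random_set \<omega> \<and> (\<forall>j\<in>{1..k}. e \<in> current_set j t \<omega> (fst \<omega> j e))"
proof -
  obtain c \<sigma> R where \<omega>: "\<omega> = (c, \<sigma>, R)" by (cases \<omega>)
  note order = set_pmf_aw_order[OF assms(1)[unfolded \<omega>]]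
  have "e \<in> snd (aw_state (\<beta> j) (I j) (\<phi> j) (c j) \<sigma> R n) \<longleftrightarrow> e \<in> R \<and> e \<in> current_set j t \<omega> (c j e)" for j
    unfolding snd_aw_state e_def using order assms(2)
    by (auto simp: \<omega> aw_order_def current_set_def nth_eq_iff_index_eq)
  \<comment> \<open>As \<open>k \<ge> 1\<close>, the intersection has a nonempty index set, which
    yields membership in \<open>R\<close>.\<close>
  then show ?thesis
    using k_pos by (auto simp: aw_output_def \<omega> aw_random_set_def)
qed

section \<open>Selection probability of the processed element\<close>

lemma mem_current_set_unprocessed:
  assumes "\<omega> \<in> set_pmf P" "t \<le> n" "e \<notin> processed t \<omega>" "e \<in> current_set j t \<omega> i"
  shows "e \<in> I j i"
proof -
  obtain c \<sigma> R where \<omega>: "\<omega> = (c, \<sigma>, R)" by (cases \<omega>)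
  note order = set_pmf_aw_order[OF assms(1)[unfolded \<omega>]]
  show ?thesis
    using assms order mem_aw_state_unprocessed[of e t \<sigma> "\<beta> j" "I j" "\<phi> j" "c j" R i]
    by (simp add: \<omega> current_set_def processed_def)
qed

lemma x_pos:
  assumes "\<omega> \<in> set_pmf P" "e \<in> aw_random_set \<omega>"
  shows "0 < x $ e"
proof (rule ccontr)
  obtain c \<sigma> R where \<omega>: "\<omega> = (c, \<sigma>, R)" by (cases \<omega>)
  assume "\<not> 0 < x $ e"
  then have "x $ e = 0" using x_range(1)[of e] by simp
  moreover have "R \<in> set_pmf (random_set_pmf U x)"
    using set_pmf_aw(4) assms(1) unfolding \<omega> by blast
  then obtain b where "b \<in> set_pmf (Pi_pmf U False (\<lambda>e. bernoulli_pmf (x $ e)))" "R = {e\<in>U. b e}"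
    unfolding random_set_pmf_def by auto
  moreover from this have "e \<in> U" "b e"
    using assms(2) by (simp_all add: \<omega> aw_random_set_def)
  ultimately have "True \<in> set_pmf (bernoulli_pmf 0)"
    by (force simp: set_Pi_pmf PiE_dflt_def)
  then show False
    by (simp add: set_pmf_iff)
qed

text \<open>With the past, the element and its membership in \<open>R\<close> given, the current
  sets are fixed and only the controllers of the element matter. These are independent across
  matroids, which gives the product.\<close>

lemma selection_law:
  assumes "\<omega> \<in> set_pmf P" "t < n" and R: "aw_order \<omega> (Suc t) \<in> aw_random_set \<omega>"
  defines "e \<equiv> aw_order \<omega> (Suc t)"
  shows "measure_pmf.prob (given P (\<lambda>\<omega>'. (aw_joint_history t \<omega>', aw_order \<omega>' (Suc t),
             aw_order \<omega>' (Suc t) \<in> aw_random_set \<omega>')) \<omega>)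
           {\<omega>'. aw_order \<omega>' (Suc t) \<in> aw_output k U \<beta> I \<phi> \<omega>'}
         = (\<Prod>j=1..k. frozen_coverage j e t \<omega> / x $ e)"
proof -
  let ?G = "given P (\<lambda>\<omega>'. (aw_joint_history t \<omega>', aw_order \<omega>' (Suc t),
             aw_order \<omega>' (Suc t) \<in> aw_random_set \<omega>')) \<omega>"
  have e: "e \<notin> processed t \<omega>"
    using processed_Suc(2)[OF assms(1,2)] by (simp add: e_def)
  have "measure_pmf.prob ?G {\<omega>'. aw_order \<omega>' (Suc t) \<in> aw_output k U \<beta> I \<phi> \<omega>'}
      = measure_pmf.prob ?G ((\<lambda>\<omega>' j. fst \<omega>' j (aw_order \<omega>' (Suc t))) -` {g. \<forall>j\<in>{1..k}. e \<in> current_set j t \<omega> (g j)})"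
  proof (rule prob_cong_support)
    fix \<omega>' assume "\<omega>' \<in> set_pmf ?G"
    then have \<omega>': "\<omega>' \<in> set_pmf P" "aw_joint_history t \<omega>' = aw_joint_history t \<omega>"
      "aw_order \<omega>' (Suc t) = e" "e \<in> aw_random_set \<omega>'"
      using assms(1) R by (auto simp: e_def)
    show "\<omega>' \<in> {\<omega>'. aw_order \<omega>' (Suc t) \<in> aw_output k U \<beta> I \<phi> \<omega>'} \<longleftrightarrow>
        \<omega>' \<in> (\<lambda>\<omega>' j. fst \<omega>' j (aw_order \<omega>' (Suc t))) -` {g. \<forall>j\<in>{1..k}. e \<in> current_set j t \<omega> (g j)}"
      using mem_aw_output[OF \<omega>'(1) assms(2)] current_set_cong[OF \<omega>'(1) assms(1) _ \<omega>'(2) order.refl] assms(2) \<omega>'(3,4)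
      by simp
  qed
  also have "\<dots> = measure_pmf.prob (ctrls e) {g. \<forall>j\<in>{1..k}. e \<in> current_set j t \<omega> (g j)}"
    unfolding e_def controllers_law[OF assms(1,2), symmetric] measure_map_pmf ..
  also have "\<dots> = (\<Prod>j=1..k. measure_pmf.prob (ctrl j e) {i. e \<in> current_set j t \<omega> i})"
    by (rule prob_ctrls)
  also have "\<dots> = (\<Prod>j=1..k. frozen_coverage j e t \<omega> / x $ e)"
  proof (intro prod.cong refl)
    fix j assume "j \<in> {1..k}"
    then show "measure_pmf.prob (ctrl j e) {i. e \<in> current_set j t \<omega> i} = frozen_coverage j e t \<omega> / x $ e"
      using x_pos[OF assms(1) R] mem_current_set_unprocessed[OF assms(1) _ e] assms(2)
      by (subst prob_ctrl) (auto simp: e_def[symmetric] frozen_coverage_unprocessed[OF assms(1) _ e])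
  qed
  finally show ?thesis .
qed

text \<open>Weierstrass' inequality applied to the relative losses. Where the positive part
  truncates \<open>p\<close> to 0, nonnegativity of the product suffices.\<close>

lemma selection_prob_ge:
  assumes "\<omega> \<in> set_pmf P" "t \<le> n" "0 < x $ e"
  shows "p (Suc t) \<omega> $ e / x $ e \<le> (\<Prod>j=1..k. frozen_coverage j e t \<omega> / x $ e)"
proof -
  let ?a = "\<lambda>j. 1 - frozen_coverage j e t \<omega> / x $ e"
  have nonneg: "0 \<le> frozen_coverage j e t \<omega> / x $ e" if "j \<in> {1..k}" for j
    using assms(3) coverage_nonneg[OF that] by (auto simp: frozen_coverage_def intro!: divide_nonneg_pos)
  have "1 - (\<Sum>j=1..k. ?a j) \<le> (\<Prod>j=1..k. 1 - ?a j)"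
    using nonneg frozen_coverage_le[OF _ assms(1,2)] assms(3)
    by (intro Weierstrass_prod_ineq) auto
  moreover have "1 - (\<Sum>j=1..k. ?a j) = (x $ e - (\<Sum>j=1..k. x $ e - frozen_coverage j e t \<omega>)) / x $ e"
    using assms(3) by (simp add: diff_divide_distrib sum_divide_distrib)
  moreover have "0 \<le> (\<Prod>j=1..k. frozen_coverage j e t \<omega> / x $ e)"
    using nonneg by (intro prod_nonneg) auto
  ultimately show ?thesis
    by (simp add: p_def max_def)
qed

section \<open>Bounds on the expected and on the total decrease\<close>

lemma exchange_unique:
  assumes "\<omega> \<in> set_pmf P" "t < n" "j \<in> {1..k}" "i \<in> {1..m j}" "i' \<in> {1..m j}"
    and "e \<in> current_set j t \<omega> i'" "f \<in> current_set j t \<omega> i" "f' \<in> current_set j t \<omega> i"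
    and "\<phi> j (run_history j t \<omega>) i i' f = Some e" "\<phi> j (run_history j t \<omega>) i i' f' = Some e"
  shows "f = f'"
proof -
  obtain c \<sigma> R where \<omega>: "\<omega> = (c, \<sigma>, R)" by (cases \<omega>)
  \<comment> \<open>The outcome lies in the support and \<open>t < n\<close>, so the maintained
    mapping is valid here; that it hits \<open>e\<close> at most once gives the claim.\<close>
  have "exchange_mapping (\<I> j) (current_set j t \<omega> i) (current_set j t \<omega> i') (\<phi> j (run_history j t \<omega>) i i')"
    using exchange[OF assms(3), unfolded maintains_exchange_mappings_def] set_pmf_aw(1,3,4)[OF assms(1)[unfolded \<omega>]] assms(2-5)
    by (simp add: \<omega> current_set_def run_history_def Let_def)
  then show ?thesis
    using assms(6-) unfolding exchange_mapping_def by blast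
qed

text \<open>Given the past, \<open>\<Delta>\<close> is dominated by a function of the step record
  alone, whose law is known from \<open>step_record_law\<close>. For unprocessed \<open>e\<close>,
  each set with \<open>e\<close> then loses it with probability at most
  \<open>1 / (n - t)\<close>.\<close>

lemma expectation_\<Delta>_le:
  assumes "\<omega> \<in> set_pmf P" "t < n" "e \<in> U"
  shows "measure_pmf.expectation (given P (aw_joint_history t) \<omega>) (\<lambda>\<omega>'. \<Delta> (Suc t) \<omega>' $ e)
           \<le> k * x $ e / (n - t)"
proof -
  let ?G = "given P (aw_joint_history t) \<omega>"
  have G: "\<omega>' \<in> set_pmf P" "aw_joint_history t \<omega>' = aw_joint_history t \<omega>" if "\<omega>' \<in> set_pmf ?G" for \<omega>'
    using that assms(1) by auto
  have processed_G: "processed t \<omega>' = processed t \<omega>" if "\<omega>' \<in> set_pmf ?G" for \<omega>'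
    using processed_cong[OF G(1)[OF that] assms(1) _ G(2)[OF that]] assms(2) by simp
  \<comment> \<open>The event that, for matroid \<open>j\<close>, the set with index
    \<open>i'\<close> gives up \<open>e\<close>. Sets and mappings are taken at
    \<open>\<omega>\<close>, which is legitimate as they depend on the past only.\<close>
  define E where "E j i' = {(f, b, g). b \<and> f \<in> current_set j t \<omega> (g j) \<and> e \<in> current_set j t \<omega> i' \<and>
      \<phi> j (run_history j t \<omega>) (g j) i' f = Some e}" for j i'
  \<comment> \<open>When \<open>e\<close> itself is the new element, the bound may be positive while
    the drop is 0; this is harmless, since \<open>ub\<close> only has to dominate.\<close>
  define ub where "ub \<omega>' = (if e \<in> processed t \<omega> then 0 else
      \<Sum>j=1..k. \<Sum>i'=1..m j. \<beta> j i' * indicator (E j i') (step_record t \<omega>'))" for \<omega>'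
  have le: "\<Delta> (Suc t) \<omega>' $ e \<le> ub \<omega>'" if \<omega>': "\<omega>' \<in> set_pmf ?G" for \<omega>'
  proof (cases "e \<in> processed t \<omega>")
    case True
    then have "e \<in> processed (Suc t) \<omega>'"
      using processed_Suc(1)[OF G(1)[OF \<omega>'] assms(2)] processed_G[OF \<omega>'] by simp
    then show ?thesis
      using \<Delta>_bounds(4)[OF G(1)[OF \<omega>'] assms(2), of e] True by (simp add: coverage_drop_def ub_def)
  next
    case False
    have "coverage_drop j e t \<omega>' \<le> (\<Sum>i'=1..m j. \<beta> j i' * indicator (E j i') (step_record t \<omega>'))"
      if j: "j \<in> {1..k}" for j
    proof -
      have "current_set j t \<omega>' = current_set j t \<omega>" "run_history j t \<omega>' = run_history j t \<omega>"
        using current_set_cong[OF G(1)[OF \<omega>'] assms(1) _ G(2)[OF \<omega>'] order.refl]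
          run_history_cong[OF G(1)[OF \<omega>'] assms(1) _ G(2)[OF \<omega>'] order.refl] assms(2) by simp_all
      \<comment> \<open>A nonzero drop forces the conditions in \<open>coverage_drop_def\<close>,
        and then the sums compare term by term; a zero drop is covered by nonnegativity.\<close>
      then have "coverage_drop j e t \<omega>' \<noteq> 0 \<Longrightarrow> ?thesis"
        by (auto simp: coverage_drop_def Let_def removed_weight_def E_def step_record_def aw_order_def
            aw_random_set_def indicator_def split: prod.splits if_splits intro!: sum_mono)
      moreover have "0 \<le> (\<Sum>i'=1..m j. \<beta> j i' * indicator (E j i') (step_record t \<omega>'))"
        using weights_nonneg[OF j] by (intro sum_nonneg) auto
      ultimately show ?thesis by (cases "coverage_drop j e t \<omega>' = 0") simp_all
    qed
    then have "(\<Sum>j=1..k. coverage_drop j e t \<omega>') \<le> ub \<omega>'"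
      using False unfolding ub_def by (auto intro!: sum_mono)
    then show ?thesis
      using \<Delta>_bounds(4)[OF G(1)[OF \<omega>'] assms(2), of e] by simp
  qed
  have int_ind: "integrable ?G (\<lambda>\<omega>'. indicator (E j i') (step_record t \<omega>') :: real)" for j i'
    by (rule measure_pmf.integrable_const_bound[where B = 1]) (auto simp: indicator_def)
  have int_ub: "integrable ?G ub"
    unfolding ub_def
    by (cases "e \<in> processed t \<omega>")
       (simp_all only: if_True if_False integrable_const Bochner_Integration.integrable_sum
          integrable_mult_right int_ind measure_pmf.integrable_const)
  have int_\<Delta>: "integrable ?G (\<lambda>\<omega>'. \<Delta> (Suc t) \<omega>' $ e)"
    using \<Delta>_bounds(1,3)[OF G(1) assms(2)]
    by (intro measure_pmf.integrable_const_bound[where B = 1]) (auto simp: AE_measure_pmf_iff)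
  have "measure_pmf.expectation ?G (\<lambda>\<omega>'. \<Delta> (Suc t) \<omega>' $ e) \<le> measure_pmf.expectation ?G ub"
    using le by (intro integral_mono_AE int_\<Delta> int_ub) (auto simp: AE_measure_pmf_iff)
  also have "\<dots> \<le> k * x $ e / (n - t)"
  proof (cases "e \<in> processed t \<omega>")
    case True
    then show ?thesis
      using x_range(1)[of e] assms(2) unfolding ub_def by simp
  next
    case False
    \<comment> \<open>A set without \<open>e\<close> cannot lose it; for a set with
      \<open>e\<close>, \<open>exchange_unique\<close> supplies the uniqueness hypothesis of
      \<open>prob_step_exchange\<close>.\<close>
    have prob_E: "measure_pmf.prob (step_pmf (processed t \<omega>)) (E j i') \<le> of_bool (e \<in> current_set j t \<omega> i') / (n - t)"
      if "j \<in> {1..k}" "i' \<in> {1..m j}" for j i'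
    proof (cases "e \<in> current_set j t \<omega> i'")
      case True
      have "processed t \<omega> \<subset> U"
        using processed_subset[OF assms(1), of t] assms(3) False by auto
      with prob_step_exchange[OF that(1), of "processed t \<omega>"
          "\<lambda>i f. f \<in> current_set j t \<omega> i \<and> \<phi> j (run_history j t \<omega>) i i' f = Some e"]
      show ?thesis
        using exchange_unique[OF assms(1,2) that(1) _ that(2) True] True card_unprocessed[OF assms(1), of t] assms(2)
        by (simp add: E_def) 
    next
      case False
      then have "E j i' = {}" by (auto simp: E_def)
      with False show ?thesis by simp
    qed
    have exp_E: "measure_pmf.expectation ?G (\<lambda>\<omega>'. indicator (E j i') (step_record t \<omega>'))
        = measure_pmf.prob (step_pmf (processed t \<omega>)) (E j i')" for j i'
    proof -
      have "map_pmf (step_record t) ?G = step_pmf (processed t \<omega>)"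
        using step_record_law[of "fst \<omega>" "fst (snd \<omega>)" "snd (snd \<omega>)" t] assms(1,2)
        by (simp add: processed_def case_prod_unfold)
      then have "measure_pmf.prob (step_pmf (processed t \<omega>)) (E j i') = measure_pmf.prob ?G (step_record t -` E j i')"
        by (metis measure_map_pmf)
      also have "\<dots> = measure_pmf.expectation ?G (indicator (step_record t -` E j i'))"
        by simp
      also have "indicator (step_record t -` E j i') = (\<lambda>\<omega>'. indicator (E j i') (step_record t \<omega>') :: real)"
        by (auto simp: indicator_def)
      finally show ?thesis ..
    qed
    have "measure_pmf.expectation ?G ub
        = (\<Sum>j=1..k. \<Sum>i'=1..m j. \<beta> j i' * measure_pmf.prob (step_pmf (processed t \<omega>)) (E j i'))"
      using False unfolding ub_def
      by (simp only: if_False Bochner_Integration.integral_sum Bochner_Integration.integrable_sum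
          integrable_mult_right integral_mult_right_zero int_ind exp_E)
    also have "\<dots> \<le> (\<Sum>j=1..k. \<Sum>i'=1..m j. \<beta> j i' * (of_bool (e \<in> current_set j t \<omega> i') / (n - t)))"
      by (intro sum_mono mult_left_mono prob_E weights_nonneg)
    also have "\<dots> = (\<Sum>j=1..k. coverage (m j) (\<beta> j) (current_set j t \<omega>) e / (n - t))"
      unfolding coverage_def sum_divide_distrib by simp
    also have "\<dots> \<le> (\<Sum>j=1..k. x $ e / (n - t))"
      using frozen_coverage_le[OF _ assms(1), of _ t e] frozen_coverage_unprocessed[OF assms(1) _ False] assms(2)
      by (intro sum_mono divide_right_mono) auto
    finally show ?thesis
      by simp
  qed
  finally show ?thesis .
qed

text \<open>Whatever the controller of the new element, each matroid loses total weight at most 1;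
  \<open>sum_removed_weight_le\<close> gives this for every outcome, not only in
  expectation.\<close>

lemma sum_\<Delta>_le:
  assumes "\<omega> \<in> set_pmf P" "t < n"
  shows "(\<Sum>e\<in>U. \<bar>\<Delta> (Suc t) \<omega> $ e\<bar>) \<le> k"
proof -
  have "(\<Sum>e\<in>U. coverage_drop j e t \<omega>) \<le> 1" if j: "j \<in> {1..k}" for j
  proof -
    let ?f = "aw_order \<omega> (Suc t)"
    let ?r = "removed_weight (m j) (\<beta> j) (current_set j t \<omega>) (\<lambda>i'. \<phi> j (run_history j t \<omega>) (fst \<omega> j ?f) i' ?f)"
    have "(\<Sum>e\<in>U. coverage_drop j e t \<omega>) \<le> (\<Sum>e\<in>U. ?r e)"
      unfolding coverage_drop_def Let_def
      by (intro sum_mono) (auto intro: removed_weight_nonneg weights_nonneg[OF j])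
    also have "\<dots> \<le> 1"
      using sum_removed_weight_le[of U "m j" "\<beta> j"] weights_nonneg[OF j] weights_sum[OF j] by auto
    finally show ?thesis .
  qed
  then have "(\<Sum>j=1..k. \<Sum>e\<in>U. coverage_drop j e t \<omega>) \<le> (\<Sum>j=1..k. 1)"
    by (intro sum_mono)
  moreover have "(\<Sum>e\<in>U. \<bar>\<Delta> (Suc t) \<omega> $ e\<bar>) \<le> (\<Sum>e\<in>U. \<Sum>j=1..k. coverage_drop j e t \<omega>)"
    using \<Delta>_bounds(1,4)[OF assms] by (intro sum_mono) auto
  ultimately show ?thesis
    using sum.swap[of "\<lambda>e j. coverage_drop j e t \<omega>" "{1..k}" U] by simp
qed

section \<open>Verification of the process conditions\<close>

lemma sequential_selection_process_aw:
  "sequential_selection_process P U x aw_joint_history aw_order aw_random_set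
     (\<lambda>\<omega>. indicator_vec (aw_output k U \<beta> I \<phi> \<omega>)) p \<Delta>"
proof
  show "0 \<le> x $ e \<and> x $ e \<le> 1" for e
    using x_range by simp
next
  fix \<omega> assume \<omega>: "\<omega> \<in> set_pmf P"
  obtain c \<sigma> R where eq: "\<omega> = (c, \<sigma>, R)" by (cases \<omega>)
  note order = set_pmf_aw_order[OF \<omega>[unfolded eq]]
  have "bij_betw ((!) \<sigma>) {..<n} U"
    using order by (intro bij_betw_nth) auto
  \<comment> \<open>Steps count from 1, list positions from 0.\<close>
  moreover have "bij_betw (\<lambda>t. t - 1) {1..n} {..<n}"
    by (rule bij_betw_byWitness[of _ Suc]) auto
  ultimately show "bij_betw (aw_order \<omega>) {1..n} U"
    using bij_betw_trans by (fastforce simp: eq aw_order_def o_def)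
  show "aw_random_set \<omega> \<subseteq> U"
    using set_pmf_aw(4)[OF \<omega>[unfolded eq]] by (auto simp: eq aw_random_set_def random_set_pmf_def)
  show "indicator_vec (aw_output k U \<beta> I \<phi> \<omega>) $ e \<in> {0, 1}" for e
    by (simp add: indicator_vec_def indicator_def)
  show "p 1 \<omega> = x"
    using x_range(1) by (simp add: vec_eq_iff p_def frozen_coverage_0)
  show "p (t + 1) \<omega> = p t \<omega> - \<Delta> t \<omega>" for t
    by (simp add: \<Delta>_def)
next
  fix t assume "t \<in> {1..n}"
  then obtain s where t: "t = Suc s" "s < n"
    by (cases t) auto
  show "determined_by P (aw_joint_history t) (aw_joint_history (t - 1))"
    by (auto simp: determined_by_def intro: aw_joint_history_mono)
  show "determined_by P (aw_joint_history t)
     (\<lambda>\<omega>. (aw_order \<omega> t, aw_order \<omega> t \<in> aw_random_set \<omega>,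
        indicator_vec (aw_output k U \<beta> I \<phi> \<omega>) $ aw_order \<omega> t, \<Delta> t \<omega>))"
    unfolding determined_by_def
  proof (intro ballI impI)
    fix \<omega> \<omega>'
    assume \<omega>: "\<omega> \<in> set_pmf P" and \<omega>': "\<omega>' \<in> set_pmf P"
      and eq: "aw_joint_history t \<omega> = aw_joint_history t \<omega>'"
    \<comment> \<open>Splitting off the last entry: equal histories after \<open>t\<close> steps
      agree on the past and on the last record.\<close>
    then have rec: "step_record s \<omega> = step_record s \<omega>'" and eq': "aw_joint_history s \<omega> = aw_joint_history s \<omega>'"
      using t(2) by (auto simp: t(1) aw_joint_history_Suc)
    then have 1: "aw_order \<omega> t = aw_order \<omega>' t"
        "aw_order \<omega>' t \<in> aw_random_set \<omega> \<longleftrightarrow> aw_order \<omega>' t \<in> aw_random_set \<omega>'"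
        "\<And>j. fst \<omega> j (aw_order \<omega>' t) = fst \<omega>' j (aw_order \<omega>' t)"
      by (auto simp: step_record_def aw_order_def aw_random_set_def t(1) fun_eq_iff split: prod.splits)
    have current_set: "current_set j s \<omega> = current_set j s \<omega>'" for j
      using current_set_cong[OF \<omega> \<omega>' _ eq' order.refl] t(2) by simp
    have "aw_order \<omega> t \<in> aw_output k U \<beta> I \<phi> \<omega> \<longleftrightarrow> aw_order \<omega>' t \<in> aw_output k U \<beta> I \<phi> \<omega>'"
      using mem_aw_output[OF \<omega> t(2)] mem_aw_output[OF \<omega>' t(2)] 1 current_set by (simp add: t(1))
    moreover have "p t \<omega> = p t \<omega>'" "p (t + 1) \<omega> = p (t + 1) \<omega>'"
      using frozen_coverage_cong[OF \<omega> \<omega>' _ eq'] frozen_coverage_cong[OF \<omega> \<omega>' _ eq] t(2)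
      by (simp_all add: p_def t(1))
    ultimately show "(aw_order \<omega> t, aw_order \<omega> t \<in> aw_random_set \<omega>,
          indicator_vec (aw_output k U \<beta> I \<phi> \<omega>) $ aw_order \<omega> t, \<Delta> t \<omega>) =
        (aw_order \<omega>' t, aw_order \<omega>' t \<in> aw_random_set \<omega>',
          indicator_vec (aw_output k U \<beta> I \<phi> \<omega>') $ aw_order \<omega>' t, \<Delta> t \<omega>')"
      using 1 by (simp add: \<Delta>_def indicator_vec_def indicator_def)
  qed
  fix \<omega> assume \<omega>: "\<omega> \<in> set_pmf P"
  have processed: "processed s \<omega> = set (take s (fst (snd \<omega>)))"
    by (simp add: processed_def case_prod_unfold)
  show "measure_pmf.prob (given P (aw_joint_history (t - 1)) \<omega>) {\<omega>'. aw_order \<omega>' t = e}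
      = 1 / (real n - real t + 1)" if "e \<in> U - aw_order \<omega> ` {1..<t}" for e
  proof -
    have "aw_order \<omega> ` {1..<t} = processed s \<omega>"
    proof -
      obtain c \<sigma> R where eq: "\<omega> = (c, \<sigma>, R)" by (cases \<omega>)
      have "set (take s \<sigma>) = (!) \<sigma> ` {..<s}"
        using set_pmf_aw_order[OF \<omega>[unfolded eq]] t(2) by (subst nth_image[symmetric]) (auto simp: lessThan_atLeast0)
      also have "{..<s} = (\<lambda>t. t - 1) ` {1..<t}"
        by (force simp: t(1) image_iff intro: bexI[of _ "Suc _"])
      finally show ?thesis
        by (simp add: eq aw_order_def processed_def image_image)
    qed
    then have e: "e \<in> U - processed s \<omega>" using that by simp
    have "measure_pmf.prob (given P (aw_joint_history s) \<omega>) {\<omega>'. aw_order \<omega>' (Suc s) = e}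
        = pmf (map_pmf (\<lambda>\<omega>'. aw_order \<omega>' (Suc s)) (given P (aw_joint_history s) \<omega>)) e"
      by (simp add: pmf_map vimage_def)
    also have "\<dots> = 1 / card (U - processed s \<omega>)"
      unfolding order_law[OF \<omega> t(2)] processed[symmetric] using e by (subst pmf_of_set) auto
    finally show ?thesis
      using card_unprocessed[OF \<omega>, of s] t by simp
  qed
  show "measure_pmf.prob (given P (\<lambda>\<omega>'. (aw_joint_history (t - 1) \<omega>', aw_order \<omega>' t)) \<omega>)
      {\<omega>'. aw_order \<omega>' t \<in> aw_random_set \<omega>'} = x $ aw_order \<omega> t"
    using arg_cong[OF random_set_law[OF \<omega> t(2)], of "\<lambda>q. pmf q True"] x_range
    by (simp add: t(1) pmf_map vimage_def)
  show "indicator_vec (aw_output k U \<beta> I \<phi> \<omega>) $ aw_order \<omega> t = 0" if "aw_order \<omega> t \<notin> aw_random_set \<omega>"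
    using that mem_aw_output[OF \<omega> t(2)] by (simp add: t(1) indicator_vec_def)
  show "p t \<omega> $ aw_order \<omega> t / x $ aw_order \<omega> t \<le>
      measure_pmf.prob (given P (\<lambda>\<omega>'. (aw_joint_history (t - 1) \<omega>', aw_order \<omega>' t,
          aw_order \<omega>' t \<in> aw_random_set \<omega>')) \<omega>)
        {\<omega>'. indicator_vec (aw_output k U \<beta> I \<phi> \<omega>') $ aw_order \<omega>' t = 1}"
    if "aw_order \<omega> t \<in> aw_random_set \<omega>"
  proof -
    have "indicator_vec A $ e = 1 \<longleftrightarrow> e \<in> A" for A :: "'u set" and e
      by (simp add: indicator_vec_def indicator_def)
    then show ?thesis
      using selection_law[OF \<omega> t(2)] selection_prob_ge[OF \<omega> _ x_pos[OF \<omega> that], of s] that t by simp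
  qed
  show "0 \<le> \<Delta> t \<omega> $ e \<and> \<Delta> t \<omega> $ e \<le> p t \<omega> $ e \<and> \<Delta> t \<omega> $ e \<le> 1" for e
    using \<Delta>_bounds[OF \<omega> t(2)] by (simp add: t(1))
qed

lemma strongly_bounded_process_aw: "strongly_bounded_process (real k) P U x aw_joint_history \<Delta>"
  unfolding strongly_bounded_process_def bounded_process_def limited_process_def
proof (intro conjI ballI)
  fix t \<omega> assume "t \<in> {1..n}" and \<omega>: "\<omega> \<in> set_pmf P"
  then obtain s where t: "t = Suc s" "s < n"
    by (cases t) auto
  show "(\<Sum>e\<in>U. \<bar>\<Delta> t \<omega> $ e\<bar>) \<le> real k"
    using sum_\<Delta>_le[OF \<omega> t(2)] by (simp add: t(1))
  show "measure_pmf.expectation (given P (aw_joint_history (t - 1)) \<omega>) (\<lambda>\<omega>'. \<Delta> t \<omega>' $ e)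
      \<le> real k * x $ e / (real n - real t + 1)" if "e \<in> U" for e
    using expectation_\<Delta>_le[OF \<omega> t(2) that] t by simp
qed

end

theorem lemma16:
  fixes U :: "'u::finite set"
    and k :: nat
    and \<I> :: "nat \<Rightarrow> 'u set set"
    and x :: "real ^ 'u"
    and m :: "nat \<Rightarrow> nat"
    and \<beta> :: "nat \<Rightarrow> nat \<Rightarrow> real"
    and I :: "nat \<Rightarrow> nat \<Rightarrow> 'u set"
    and \<phi> :: "nat \<Rightarrow> 'u exchange_rule"
  assumes "k \<ge> 1"
    and "\<And>j. j \<in> {1..k} \<Longrightarrow> matroid U (\<I> j)"
    and "x \<in> (\<Inter>j\<in>{1..k}. matroid_polytope (\<I> j))"
    and "\<And>j. j \<in> {1..k} \<Longrightarrow> convex_decomposition U (\<I> j) x (m j) (\<beta> j) (I j)"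
    and "\<And>j. j \<in> {1..k} \<Longrightarrow>
           maintains_exchange_mappings U (\<I> j) x (m j) (\<beta> j) (I j) (\<phi> j)"
  shows "\<exists>p \<Delta>.
     sequential_selection_process (aw_pmf k U x m \<beta> I) U x aw_joint_history aw_order aw_random_set
       (\<lambda>\<omega>. indicator_vec (aw_output k U \<beta> I \<phi> \<omega>)) p \<Delta> \<and>
     strongly_bounded_process (real k) (aw_pmf k U x m \<beta> I) U x aw_joint_history \<Delta>"
proof -
  interpret aw_scheme U k \<I> x m \<beta> I \<phi>
    using assms by unfold_locales
  show ?thesis
    using sequential_selection_process_aw strongly_bounded_process_aw by blast
qed

end
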